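(* Assume that $l_0,l_1,l_2,l_3\in\mathbb Z_{\ge0}$, that $\delta_1,\dots,\delta_M\in\mathbb C$ satisfy $$2\sum _{j' \neq j} (\wp ' (\delta _j -\delta _{j'} ) + \wp ' (\delta _j +\delta _{j'} ) )+ \sum _{i=0}^3 (l_i +1/2)^2 \wp ' (\delta _j +\omega _i ) =0 \quad (j=1,\dots ,M),$$ that $\delta_j\not\equiv\omega_i \bmod 2\omega_1\mathbb Z\oplus2\omega_3\mathbb Z$ ($0\le i\le3$, $1\le j\le M$) and that $\delta_j\pm\delta_{j'}\not\equiv0\bmod 2\omega_1\mathbb Z\oplus2\omega_3\mathbb Z$ ($1\le j<j'\le M$). Let $$v(x)=\sum_{i=0}^3 l_i(l_i+1) \wp (x+\omega_i) +2\sum_{i'=1}^M (\wp (x-\delta _{i'}) + \wp (x+\delta _{i'})),$$ and let $a_j(x)$ ($j=0,\dots,g$) be the functions defined in the context. Define the $(2g+1)$st-order differential operator $$A= \sum_{j=0}^{g} \left\{ a_j(x)\frac{d}{dx}-\frac{1}{2} \left( \frac{d}{dx} a_j(x) \right) \right\} \left( - \frac{d^2}{dx^2} +v(x) \right) ^{g-j}.$$ Then $A$ commutes with the operator $H=-d^2/dx^2+v(x)$. In other words, $v(x)$ is an algebro-geometric finite-gap potential.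
   Context: Fix $\omega_1,\omega_3\in\mathbb C$ linearly independent over $\mathbb R$; $\omega_0=0$, $\omega_2=-\omega_1-\omega_3$; $\wp$ is the Weierstrass function with periods $(2\omega_1,2\omega_3)$. A function $q(x)$ is called an algebro-geometric finite-gap potential if there is an odd-order differential operator $\left(d/dx\right)^{2g+1}+\sum_{j=0}^{2g-1}b_j(x)\left(d/dx\right)^{2g-1-j}$ commuting with $-d^2/dx^2+q(x)$. Under the hypotheses of the claim there is a unique function $\Xi(x,E)$, non-zero and doubly-periodic in $x$ (periods $2\omega_1,2\omega_3$), which satisfies for all $E$ $$\Xi'''-4(v(x)-E)\Xi'-2v'(x)\Xi=0\qquad({}'=d/dx)$$ and has the form $$\Xi (x,E)=c_0(E)+\sum_{i=0}^3 \sum_{j=0}^{l_i-1} b^{(i)}_j (E)\wp (x+\omega_i)^{l_i-j}+ \sum _{i'=1}^M d^{(i')}(E)(\wp (x+\delta _{i'}) +\wp (x- \delta _{i'})),$$ where the coefficients are polynomials in $E$ without common divisors and $c_0(E)$ is monic. Put $g=\deg_Ec_0(E)$; the other coefficients have degree $<g$. The functions $a_j(x)$ are defined by $\Xi(x,E)=\sum_{i=0}^g a_{g-i}(x)E^i$ (so $a_0(x)=1$). *)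

theory Defs
  imports "HOL-Complex_Analysis.Complex_Analysis"
begin

definition period_lattice :: "complex \<Rightarrow> complex \<Rightarrow> complex set" where
  "period_lattice \<omega>1 \<omega>3 =
     {2 * of_int m * \<omega>1 + 2 * of_int n * \<omega>3 | m n. True}"

definition half_period :: "complex \<Rightarrow> complex \<Rightarrow> nat \<Rightarrow> complex" where
  "half_period \<omega>1 \<omega>3 i = [0, \<omega>1, - \<omega>1 - \<omega>3, \<omega>3] ! i"

text \<open>
  The Weierstrass function with periods \<open>2 * \<omega>1\<close> and \<open>2 * \<omega>3\<close>. Its values at the lattice points
  carry no meaning and are never used below.
\<close>

definition wp :: "complex \<Rightarrow> complex \<Rightarrow> complex \<Rightarrow> complex" where
  "wp \<omega>1 \<omega>3 z = 1 / z ^ 2 +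
     (\<Sum>\<^sub>\<infinity>w \<in> period_lattice \<omega>1 \<omega>3 - {0}. 1 / (z - w) ^ 2 - 1 / w ^ 2)"

text \<open>
  Throughout, \<open>l\<close> is used at the indices \<open>0, \<dots>, 3\<close> only and \<open>\<delta>\<close> at the indices \<open>1, \<dots>, M\<close> only.
\<close>

definition potential ::
  "complex \<Rightarrow> complex \<Rightarrow> (nat \<Rightarrow> nat) \<Rightarrow> nat \<Rightarrow> (nat \<Rightarrow> complex) \<Rightarrow> complex \<Rightarrow> complex" where
  "potential \<omega>1 \<omega>3 l M \<delta> x =
     (\<Sum>i=0..3. of_nat (l i * (l i + 1)) * wp \<omega>1 \<omega>3 (x + half_period \<omega>1 \<omega>3 i)) +
     2 * (\<Sum>k=1..M. wp \<omega>1 \<omega>3 (x - \<delta> k) + wp \<omega>1 \<omega>3 (x + \<delta> k))"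

text \<open>
  The plane without the poles of the functions \<open>wp (x + \<omega>\<^sub>i)\<close> and \<open>wp (x \<plusminus> \<delta>\<^sub>k)\<close>. Identities between
  the meromorphic functions below are stated on this dense open set.
\<close>

definition regular_set ::
  "complex \<Rightarrow> complex \<Rightarrow> nat \<Rightarrow> (nat \<Rightarrow> complex) \<Rightarrow> complex set" where
  "regular_set \<omega>1 \<omega>3 M \<delta> =
     {x. (\<forall>i\<le>3. x + half_period \<omega>1 \<omega>3 i \<notin> period_lattice \<omega>1 \<omega>3) \<and>
         (\<forall>k\<in>{1..M}. x + \<delta> k \<notin> period_lattice \<omega>1 \<omega>3 \<and> x - \<delta> k \<notin> period_lattice \<omega>1 \<omega>3)}"

definition Xi ::
  "complex \<Rightarrow> complex \<Rightarrow> (nat \<Rightarrow> nat) \<Rightarrow> nat \<Rightarrow> (nat \<Rightarrow> complex) \<Rightarrow>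
   complex poly \<Rightarrow> (nat \<Rightarrow> nat \<Rightarrow> complex poly) \<Rightarrow> (nat \<Rightarrow> complex poly) \<Rightarrow>
   complex \<Rightarrow> complex \<Rightarrow> complex" where
  "Xi \<omega>1 \<omega>3 l M \<delta> c0 b d x E =
     poly c0 E +
     (\<Sum>i=0..3. \<Sum>j<l i. poly (b i j) E * wp \<omega>1 \<omega>3 (x + half_period \<omega>1 \<omega>3 i) ^ (l i - j)) +
     (\<Sum>k=1..M. poly (d k) E * (wp \<omega>1 \<omega>3 (x + \<delta> k) + wp \<omega>1 \<omega>3 (x - \<delta> k)))"

text \<open>
  \<open>c0\<close>, \<open>b\<close>, \<open>d\<close> are the coefficients of the normalized doubly periodic solution \<open>\<Xi>(x, E)\<close> of the
  equation satisfied by products of two solutions of \<open>- f'' + v f = E f\<close>.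
\<close>

definition is_Xi_coeffs ::
  "complex \<Rightarrow> complex \<Rightarrow> (nat \<Rightarrow> nat) \<Rightarrow> nat \<Rightarrow> (nat \<Rightarrow> complex) \<Rightarrow>
   complex poly \<Rightarrow> (nat \<Rightarrow> nat \<Rightarrow> complex poly) \<Rightarrow> (nat \<Rightarrow> complex poly) \<Rightarrow> bool" where
  "is_Xi_coeffs \<omega>1 \<omega>3 l M \<delta> c0 b d \<longleftrightarrow>
     (let S = regular_set \<omega>1 \<omega>3 M \<delta>;
          v = potential \<omega>1 \<omega>3 l M \<delta>;
          \<Xi> = Xi \<omega>1 \<omega>3 l M \<delta> c0 b d
      in (\<exists>x\<in>S. \<exists>E. \<Xi> x E \<noteq> 0) \<and>
         (\<forall>x\<in>S. \<forall>E. \<Xi> (x + 2 * \<omega>1) E = \<Xi> x E \<and> \<Xi> (x + 2 * \<omega>3) E = \<Xi> x E) \<and>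
         (\<forall>x\<in>S. \<forall>E. (deriv ^^ 3) (\<lambda>y. \<Xi> y E) x - 4 * (v x - E) * deriv (\<lambda>y. \<Xi> y E) x
                        - 2 * deriv v x * \<Xi> x E = 0) \<and>
         (\<forall>p. p dvd c0 \<and> (\<forall>i\<le>3. \<forall>j<l i. p dvd b i j) \<and> (\<forall>k\<in>{1..M}. p dvd d k)
              \<longrightarrow> is_unit p) \<and>
         lead_coeff c0 = 1 \<and>
         (\<forall>i\<le>3. \<forall>j<l i. degree (b i j) < degree c0) \<and>
         (\<forall>k\<in>{1..M}. degree (d k) < degree c0))"

definition schroedinger_op ::
  "(complex \<Rightarrow> complex) \<Rightarrow> (complex \<Rightarrow> complex) \<Rightarrow> complex \<Rightarrow> complex" where
  "schroedinger_op q f = (\<lambda>x. - (deriv ^^ 2) f x + q x * f x)"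

definition A_op ::
  "(complex \<Rightarrow> complex) \<Rightarrow> nat \<Rightarrow> (nat \<Rightarrow> complex \<Rightarrow> complex) \<Rightarrow>
   (complex \<Rightarrow> complex) \<Rightarrow> complex \<Rightarrow> complex" where
  "A_op v g a f = (\<lambda>x. \<Sum>j=0..g.
     a j x * deriv ((schroedinger_op v ^^ (g - j)) f) x
     - 1 / 2 * deriv (a j) x * (schroedinger_op v ^^ (g - j)) f x)"

text \<open>
  Commutation of differential operators whose coefficients are holomorphic on \<open>S\<close>, tested on all
  locally defined holomorphic functions.
\<close>

definition commute_on ::
  "complex set \<Rightarrow> ((complex \<Rightarrow> complex) \<Rightarrow> complex \<Rightarrow> complex) \<Rightarrow>
   ((complex \<Rightarrow> complex) \<Rightarrow> complex \<Rightarrow> complex) \<Rightarrow> bool" where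
  "commute_on S P Q \<longleftrightarrow>
     (\<forall>U f. open U \<and> U \<subseteq> S \<and> f holomorphic_on U \<longrightarrow> (\<forall>x\<in>U. P (Q f) x = Q (P f) x))"

text \<open>
  Potential and coefficients are meromorphic on the plane; the operators are compared where all of
  these functions are analytic, which for meromorphic functions is a dense open set.
\<close>

definition finite_gap_potential :: "(complex \<Rightarrow> complex) \<Rightarrow> bool" where
  "finite_gap_potential q \<longleftrightarrow> q meromorphic_on UNIV \<and>
     (\<exists>g (b :: nat \<Rightarrow> complex \<Rightarrow> complex).
        (\<forall>j<2*g. b j meromorphic_on UNIV) \<and>
        commute_on {x. q analytic_on {x} \<and> (\<forall>j<2*g. b j analytic_on {x})}
          (\<lambda>f x. (deriv ^^ (2*g+1)) f x + (\<Sum>j<2*g. b j x * (deriv ^^ (2*g-1-j)) f x))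
          (schroedinger_op q))"

end

theory Submission
  imports Defs
begin

text \<open>
  The functions \<open>f\<^sub>k\<close> given by \<open>f\<^sub>0 = 1\<close> and \<open>4 f\<^bsub>k+1\<^esub>' = 4 v f\<^sub>k' + 2 v' f\<^sub>k - f\<^sub>k'''\<close> are differential
  polynomials in \<open>v\<close>, and the commutator of \<open>A\<close> with \<open>H\<close> telescopes as soon as the coefficients \<open>a\<^sub>j\<close>
  satisfy this recursion with \<open>a\<^bsub>g+1\<^esub>' = 0\<close>. For the \<open>a\<^sub>j\<close> of the theorem this is the third-order equation
  for \<open>\<Xi>\<close>, read off coefficientwise in \<open>E\<close>.

  That \<open>v\<close> is finite-gap is shown without constructing \<open>\<Xi>\<close>. By the hypotheses on the \<open>\<delta>\<^sub>j\<close> and the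
  duplication formula for \<open>\<wp>'\<close>, near each pole \<open>v = l (l + 1) / x\<^sup>2 + \<Sum> c\<^sub>i x\<^sup>i\<close> with \<open>c\<^sub>i = 0\<close> for odd
  \<open>i < 2 l\<close>. The recursion then keeps the pole orders of all \<open>f\<^sub>k\<close> at most \<open>2 l\<close>, because its leading
  coefficient vanishes exactly at the order \<open>2 l\<close>. So the elliptic functions \<open>f\<^sub>k\<close> span a
  finite-dimensional space, and a monic linear relation among the \<open>f\<^sub>k\<close> modulo constants gives the \<open>a\<^sub>j\<close>.
\<close>

text \<open>The second conclusion carries no hypothesis on \<Xi>, and the existence of \<Xi> is not
  established here. Hence two independent families of coefficients feed the same commutator
  computation: the given \<open>a\<close> for the first conclusion, combinations of the f_k for the
  second. The order 2K + 1 obtained for the second comes from linear dependence in a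
  finite-dimensional space; it is not compared with the degree of \<open>c0\<close>.

  The bound 2l on the pole order cannot be carried through the recursion alone. For l > 0 the
  coefficient of f_(k+1) at order -2l-1 is a nonzero multiple of that of f_k at order -2l+1, so the
  induction must also carry the vanishing of all odd negative orders. Preserving this second
  invariant is what consumes the vanishing of the odd c_i all the way up to i = 2l-1: such a c_i
  multiplies even polar coefficients of f_k and would otherwise feed into odd negative
  orders.\<close>

unbundle fps_syntax

section \<open>Gelfand--Dikii polynomials\<close>

text \<open>Up to normalisation, the second Hamiltonian operator of the KdV hierarchy. In these
  terms the third-order equation for \<Xi> reads \<open>kdv_op v \<Xi> = 4 E \<Xi>'\<close>, so one
  operator serves both the recursion and the comparison of powers of E.\<close>

definition kdv_op :: "(complex \<Rightarrow> complex) \<Rightarrow> (complex \<Rightarrow> complex) \<Rightarrow> complex \<Rightarrow> complex" where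
  "kdv_op v f x = 4 * v x * deriv f x + 2 * deriv v x * f x - deriv (deriv (deriv f)) x"

text \<open>
  The linear recursion determines \<open>f\<^bsub>k+1\<^esub>\<close> only up to a primitive. Its first integral defines
  \<open>f\<^bsub>k+1\<^esub>\<close> without integration, hence as a single-valued meromorphic function.
\<close>

fun gelfand_dikii :: "(complex \<Rightarrow> complex) \<Rightarrow> nat \<Rightarrow> complex \<Rightarrow> complex" where
  "gelfand_dikii v 0 = (\<lambda>x. 1)"
| "gelfand_dikii v (Suc k) = (\<lambda>x.
     (\<Sum>j=0..k. v x * (gelfand_dikii v j x * gelfand_dikii v (k - j) x)
        + deriv (gelfand_dikii v j) x * deriv (gelfand_dikii v (k - j)) x / 4
        - gelfand_dikii v j x * deriv (deriv (gelfand_dikii v (k - j))) x / 2) / 2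
     - (\<Sum>j=1..k. gelfand_dikii v j x * gelfand_dikii v (Suc k - j) x) / 2)"

declare gelfand_dikii.simps(2) [simp del]

lemma gelfand_dikii_holomorphic:
  assumes "open S" "v holomorphic_on S"
  shows "gelfand_dikii v k holomorphic_on S"
proof (induction k rule: less_induct)
  case (less k)
  show ?case
    by (cases k) (auto simp: gelfand_dikii.simps(2) intro!: holomorphic_intros less assms)
qed

lemma gelfand_dikii_meromorphic:
  assumes "v meromorphic_on UNIV"
  shows "gelfand_dikii v k meromorphic_on UNIV"
proof (induction k rule: less_induct)
  case (less k)
  show ?case
    by (cases k) (auto simp: gelfand_dikii.simps(2) intro!: meromorphic_intros less assms)
qed

text \<open>No differentiability is required: \<open>deriv\<close> is a choice from the derivative
  relation, and that relation is itself shift invariant. Periodicity therefore passes to derivatives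
  even at poles.\<close>

lemma deriv_add_shift:
  fixes f :: "complex \<Rightarrow> complex"
  shows "deriv f (x + p) = deriv (\<lambda>y. f (y + p)) x"
  unfolding deriv_def by (simp add: DERIV_shift)

lemma gelfand_dikii_periodic:
  assumes "\<And>x. v (x + p) = v x"
  shows "gelfand_dikii v k (x + p) = gelfand_dikii v k x"
proof (induction k arbitrary: x rule: less_induct)
  case (less k)
  show ?case
  proof (cases k)
    case (Suc m)
    have 1: "deriv (gelfand_dikii v j) (x + p) = deriv (gelfand_dikii v j) x" if "j < k" for j x
      using less[OF that] by (simp add: deriv_add_shift)
    have 2: "deriv (deriv (gelfand_dikii v j)) (x + p) = deriv (deriv (gelfand_dikii v j)) x" if "j < k" for j x
      using 1[OF that] by (simp add: deriv_add_shift[of "deriv _"])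
    show ?thesis
      unfolding Suc gelfand_dikii.simps(2)
      by (intro arg_cong2[where f = "(-)"] arg_cong2[where f = "(/)"] sum.cong refl)
         (auto simp: Suc assms 1 2 less)
  qed auto
qed

text \<open>As f_0 = 1, the terms j = 0 and j = k+1 on the left are both f_(k+1). The definition is
  this symmetric identity solved for them, which explains its factors 1/2.\<close>

lemma gelfand_dikii_convolution:
  "(\<Sum>j=0..Suc k. gelfand_dikii v j x * gelfand_dikii v (Suc k - j) x) =
   (\<Sum>j=0..k. v x * (gelfand_dikii v j x * gelfand_dikii v (k - j) x)
        + deriv (gelfand_dikii v j) x * deriv (gelfand_dikii v (k - j)) x / 4
        - gelfand_dikii v j x * deriv (deriv (gelfand_dikii v (k - j))) x / 2)" (is "?L = ?R")
proof -
  have "{0..Suc k} = insert 0 (insert (Suc k) {1..k})" by auto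
  then have "?L = 2 * gelfand_dikii v (Suc k) x + (\<Sum>j=1..k. gelfand_dikii v j x * gelfand_dikii v (Suc k - j) x)"
    by simp
  also have "\<dots> = ?R"
    unfolding gelfand_dikii.simps(2) by (simp add: algebra_simps)
  finally show ?thesis .
qed

text \<open>
  The generating function \<open>F = \<Sum> f\<^sub>k X\<^sup>k\<close> satisfies \<open>F\<^sup>2 - 1 = X (v F\<^sup>2 + F'\<^sup>2 / 4 - F F'' / 2)\<close>; the
  derivative of this identity is \<open>F\<close> times the linear recursion.
\<close>

lemma gelfand_dikii_recursion:
  assumes "open S" "v holomorphic_on S" "x \<in> S"
  shows "4 * deriv (gelfand_dikii v (Suc k)) x = kdv_op v (gelfand_dikii v k) x"
proof -
  define f where "f = gelfand_dikii v"
  define f1 f2 f3 where "f1 = (\<lambda>k. deriv (f k))" and "f2 = (\<lambda>k. deriv (f1 k))" and "f3 = (\<lambda>k. deriv (f2 k))"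
  note hol = gelfand_dikii_holomorphic[OF assms(1,2)]
  have d0 [derivative_intros]: "(f k has_field_derivative f1 k x) (at x)" for k
    unfolding f1_def f_def using assms hol by (intro holomorphic_derivI) auto
  have d1 [derivative_intros]: "(f1 k has_field_derivative f2 k x) (at x)" for k
    unfolding f2_def f1_def f_def using assms hol by (intro holomorphic_derivI holomorphic_intros) auto
  have d2 [derivative_intros]: "(f2 k has_field_derivative f3 k x) (at x)" for k
    unfolding f3_def f2_def f1_def f_def using assms hol by (intro holomorphic_derivI holomorphic_intros) auto
  have dv [derivative_intros]: "(v has_field_derivative deriv v x) (at x)"
    using assms by (intro holomorphic_derivI) auto
  define F F1 F2 F3 where "F = Abs_fps (\<lambda>k. f k x)" and "F1 = Abs_fps (\<lambda>k. f1 k x)"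
    and "F2 = Abs_fps (\<lambda>k. f2 k x)" and "F3 = Abs_fps (\<lambda>k. f3 k x)"
  note F_defs = F_def F1_def F2_def F3_def
  let ?c = "fps_const :: complex \<Rightarrow> _"
  \<comment> \<open>Differentiating in x, the F' F'' terms coming from F'^2 / 4 and from F F'' / 2
    cancel, so that every remaining term contains the factor \<open>F\<close>.\<close>
  have "2 * (F * F1) = fps_X * (?c (deriv v x) * (F * F) + ?c (2 * v x) * (F * F1) - ?c (1/2) * (F * F3))"
  proof (rule fps_ext)
    fix n
    show "(2 * (F * F1)) $ n = (fps_X * (?c (deriv v x) * (F * F) + ?c (2 * v x) * (F * F1) - ?c (1/2) * (F * F3))) $ n"
    proof (cases n)
      case 0
      have "f1 0 x = 0" by (simp add: f1_def f_def)
      then show ?thesis by (simp add: 0 F_defs fps_mult_nth)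
    next
      case (Suc k)
      have "((\<lambda>y. \<Sum>j=0..Suc k. f j y * f (Suc k - j) y) has_field_derivative
              (\<Sum>j=0..Suc k. f1 j x * f (Suc k - j) x + f1 (Suc k - j) x * f j x)) (at x)"
        by (rule derivative_intros d0)+
      moreover have "((\<lambda>y. \<Sum>j=0..k. v y * (f j y * f (k - j) y) + f1 j y * f1 (k - j) y / 4 - f j y * f2 (k - j) y / 2)
          has_field_derivative (\<Sum>j=0..k. deriv v x * (f j x * f (k - j) x) + (f1 j x * f (k - j) x + f1 (k - j) x * f j x) * v x
             + (f2 j x * f1 (k - j) x + f2 (k - j) x * f1 j x) / 4 - (f1 j x * f2 (k - j) x + f3 (k - j) x * f j x) / 2)) (at x)"
        by (rule DERIV_cdivide derivative_intros d0 d1 d2 dv)+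
      moreover have "(\<lambda>y. \<Sum>j=0..Suc k. f j y * f (Suc k - j) y) =
         (\<lambda>y. \<Sum>j=0..k. v y * (f j y * f (k - j) y) + f1 j y * f1 (k - j) y / 4 - f j y * f2 (k - j) y / 2)"
        unfolding f_def f1_def f2_def using gelfand_dikii_convolution by blast
      ultimately have eq: "(\<Sum>j=0..Suc k. f1 j x * f (Suc k - j) x + f1 (Suc k - j) x * f j x) =
         (\<Sum>j=0..k. deriv v x * (f j x * f (k - j) x) + (f1 j x * f (k - j) x + f1 (k - j) x * f j x) * v x
             + (f2 j x * f1 (k - j) x + f2 (k - j) x * f1 j x) / 4 - (f1 j x * f2 (k - j) x + f3 (k - j) x * f j x) / 2)"
        using DERIV_unique by (metis (no_types, lifting))
      have "(2 * (F * F1)) $ Suc k = (F1 * F + F * F1) $ Suc k"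
        by (simp add: algebra_simps)
      also have "\<dots> = (\<Sum>j=0..Suc k. f1 j x * f (Suc k - j) x + f1 (Suc k - j) x * f j x)"
        unfolding fps_add_nth fps_mult_nth F_defs by (simp only: fps_nth_Abs_fps sum.distrib mult.commute)
      also have "\<dots> = (?c (deriv v x) * (F * F) + (F1 * F + F * F1) * ?c (v x) + (F2 * F1 + F1 * F2) * ?c (1/4)
            - (F1 * F2 + F * F3) * ?c (1/2)) $ k"
        unfolding eq fps_sub_nth fps_add_nth fps_mult_left_const_nth fps_mult_right_const_nth
        unfolding F_defs fps_nth_Abs_fps fps_mult_nth
        by (simp add: sum.distrib sum_subtractf sum_distrib_left sum_divide_distrib
              add_divide_distrib algebra_simps)
      also have "?c (deriv v x) * (F * F) + (F1 * F + F * F1) * ?c (v x) + (F2 * F1 + F1 * F2) * ?c (1/4)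
            - (F1 * F2 + F * F3) * ?c (1/2) = ?c (deriv v x) * (F * F) + ?c (2 * v x) * (F * F1) - ?c (1/2) * (F * F3)"
      proof -
        have h: "?c (1/2) = 2 * ?c (1/4)" "?c (2 * v x) = 2 * ?c (v x)"
          by (simp_all flip: fps_const_mult add: numeral_fps_const)
        show ?thesis unfolding h by (simp add: algebra_simps)
      qed
      finally show ?thesis by (simp add: Suc)
    qed
  qed
  then have "F * (2 * F1 - fps_X * (?c (deriv v x) * F + ?c (2 * v x) * F1 - ?c (1/2) * F3)) = 0"
    by (simp add: algebra_simps)
  \<comment> \<open>Power series over a field have no zero divisors, so the nonzero factor
    \<open>F\<close> can be cancelled.\<close>
  moreover have "F $ 0 = 1" by (simp add: F_def f_def)
  then have "F \<noteq> 0" by auto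
  ultimately have "2 * F1 = fps_X * (?c (deriv v x) * F + ?c (2 * v x) * F1 - ?c (1/2) * F3)"
    by auto
  then have "(2 * F1) $ Suc k = (fps_X * (?c (deriv v x) * F + ?c (2 * v x) * F1 - ?c (1/2) * F3)) $ Suc k"
    by simp
  then have "2 * f1 (Suc k) x = deriv v x * f k x + 2 * v x * f1 k x - f3 k x / 2"
    by (simp add: F_defs numeral_fps_const)
  then have "4 * f1 (Suc k) x = 4 * v x * f1 k x + 2 * deriv v x * f k x - f3 k x"
    by (simp add: field_simps)
  then show ?thesis
    unfolding kdv_op_def f1_def f2_def f3_def f_def .
qed

section \<open>The commutator\<close>

lemma schroedinger_op_holomorphic:
  assumes "open U" "v holomorphic_on U" "f holomorphic_on U"
  shows "schroedinger_op v f holomorphic_on U"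
  using assms unfolding schroedinger_op_def by (auto intro!: holomorphic_intros simp: numeral_2_eq_2)

lemma schroedinger_op_power_holomorphic:
  assumes "open U" "v holomorphic_on U" "f holomorphic_on U"
  shows "(schroedinger_op v ^^ n) f holomorphic_on U"
  by (induction n) (auto intro!: schroedinger_op_holomorphic assms)

text \<open>The zeroth-order term -a'/2 of \<open>B\<close> is chosen so that the first-order part
  of the commutator cancels. What is left is 2 a' f'' + (a v' - a'''/2) f, and replacing f'' by v f
  - H f produces \<open>kdv_op\<close>.\<close>

lemma schroedinger_op_first_order_commutator:
  fixes a f v :: "complex \<Rightarrow> complex"
  assumes "open U" "v holomorphic_on U" "a holomorphic_on U" "f holomorphic_on U" "x \<in> U"
  defines "B \<equiv> \<lambda>f y. a y * deriv f y - 1 / 2 * deriv a y * f y"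
  shows "B (schroedinger_op v f) x - schroedinger_op v (B f) x =
     kdv_op v a x / 2 * f x - 2 * deriv a x * schroedinger_op v f x"
proof -
  have D: "(h has_field_derivative deriv h y) (at y)" if "h holomorphic_on U" "y \<in> U" for h y
    using that assms(1) by (intro holomorphic_derivI)
  have ah: "deriv a holomorphic_on U" "deriv (deriv a) holomorphic_on U" and fh: "deriv f holomorphic_on U" "deriv (deriv f) holomorphic_on U"
    using assms by (auto intro!: holomorphic_intros)
  note [derivative_intros] = D[OF assms(2)] D[OF assms(3)] D[OF assms(4)] D[OF ah(1)] D[OF ah(2)] D[OF fh(1)] D[OF fh(2)]
  have 1: "deriv (B f) y = a y * deriv (deriv f) y + deriv a y * deriv f y / 2 - deriv (deriv a) y * f y / 2"
    if "y \<in> U" for y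
    unfolding B_def using that by (intro DERIV_imp_deriv) (auto intro!: derivative_eq_intros simp: field_simps)
  have "deriv (deriv (B f)) x = deriv (\<lambda>y. a y * deriv (deriv f) y + deriv a y * deriv f y / 2 - deriv (deriv a) y * f y / 2) x"
    using 1 assms(1,5) by (intro deriv_cong_ev) (auto simp: eventually_nhds)
  also have "\<dots> = a x * deriv (deriv (deriv f)) x + 3 / 2 * deriv a x * deriv (deriv f) x - deriv (deriv (deriv a)) x * f x / 2"
    using assms(5) by (intro DERIV_imp_deriv) (auto intro!: derivative_eq_intros simp: field_simps)
  finally have 2: "deriv (deriv (B f)) x = \<dots>" .
  have 3: "deriv (schroedinger_op v f) x = - deriv (deriv (deriv f)) x + deriv v x * f x + v x * deriv f x"
    unfolding schroedinger_op_def numeral_2_eq_2 using assms(5)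
    by (intro DERIV_imp_deriv) (auto intro!: derivative_eq_intros simp: field_simps)
  have 4: "schroedinger_op v h y = - deriv (deriv h) y + v y * h y" for h y
    by (simp add: schroedinger_op_def numeral_2_eq_2)
  have 5: "schroedinger_op v (B f) x = - (a x * deriv (deriv (deriv f)) x + 3 / 2 * deriv a x * deriv (deriv f) x - deriv (deriv (deriv a)) x * f x / 2)
     + v x * (a x * deriv f x - 1 / 2 * deriv a x * f x)"
    unfolding 4 2 by (simp add: B_def)
  have 6: "B (schroedinger_op v f) x = a x * (- deriv (deriv (deriv f)) x + deriv v x * f x + v x * deriv f x)
     - 1 / 2 * deriv a x * (- deriv (deriv f) x + v x * f x)"
    by (simp add: B_def 3 4)
  show ?thesis
    unfolding 5 6 kdv_op_def 4[of f x] by (simp add: field_simps)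
qed

lemma schroedinger_op_sum:
  assumes "open U" "x \<in> U" "\<And>j. j \<in> J \<Longrightarrow> h j holomorphic_on U"
  shows "schroedinger_op v (\<lambda>y. \<Sum>j\<in>J. h j y) x = (\<Sum>j\<in>J. schroedinger_op v (h j) x)"
proof -
  have "(deriv ^^ 2) (\<lambda>y. \<Sum>j\<in>J. h j y) x = (\<Sum>j\<in>J. (deriv ^^ 2) (h j) x)"
  proof -
    have 1: "deriv (\<lambda>y. \<Sum>j\<in>J. h j y) y = (\<Sum>j\<in>J. deriv (h j) y)" if "y \<in> U" for y
      using that assms by (intro DERIV_imp_deriv DERIV_sum holomorphic_derivI[of _ U]) auto
    have "deriv (deriv (\<lambda>y. \<Sum>j\<in>J. h j y)) x = deriv (\<lambda>y. \<Sum>j\<in>J. deriv (h j) y) x"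
      using 1 assms by (intro deriv_cong_ev) (auto simp: eventually_nhds)
    also have "\<dots> = (\<Sum>j\<in>J. deriv (deriv (h j)) x)"
      using assms by (intro DERIV_imp_deriv DERIV_sum holomorphic_derivI[of _ U] holomorphic_intros) auto
    finally show ?thesis by (simp add: numeral_2_eq_2)
  qed
  then show ?thesis
    by (simp add: schroedinger_op_def sum.distrib sum_negf sum_distrib_left sum_subtractf)
qed

text \<open>
  Each summand of \<open>A\<close> contributes \<open>2 a\<^bsub>j+1\<^esub>' H\<^bsup>g-j\<^esup> - 2 a\<^sub>j' H\<^bsup>g-j+1\<^esup>\<close> to the commutator, so the sum telescopes.
\<close>

theorem A_op_commute:
  assumes S: "open S" and v: "v holomorphic_on S" and a: "\<And>j. j \<le> g \<Longrightarrow> a j holomorphic_on S"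
    and a0: "\<And>x. x \<in> S \<Longrightarrow> deriv (a 0) x = 0"
    and rec: "\<And>j x. j < g \<Longrightarrow> x \<in> S \<Longrightarrow> 4 * deriv (a (Suc j)) x = kdv_op v (a j) x"
    and stat: "\<And>x. x \<in> S \<Longrightarrow> kdv_op v (a g) x = 0"
  shows "commute_on S (A_op v g a) (schroedinger_op v)"
  unfolding commute_on_def
proof (intro allI impI ballI, elim conjE)
  fix U f x assume U: "open U" "U \<subseteq> S" and f: "f holomorphic_on U" and x: "x \<in> U"
  have vU: "v holomorphic_on U" and aU: "\<And>j. j \<le> g \<Longrightarrow> a j holomorphic_on U"
    using v a U by (auto intro: holomorphic_on_subset)
  define H where "H = schroedinger_op v"
  define F where "F n = (H ^^ n) f" for n
  have F: "F n holomorphic_on U" for n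
    unfolding F_def H_def by (rule schroedinger_op_power_holomorphic[OF U(1) vU f])
  have HF: "H (F n) = F (Suc n)" for n by (simp add: F_def)
  define B where "B j h y = a j y * deriv h y - 1 / 2 * deriv (a j) y * h y" for j h y
  \<comment> \<open>The cutoff makes the upper end \<open>t (Suc g)\<close> vanish; accordingly the
    summand j = g uses the stationarity hypothesis in place of the recursion.\<close>
  define t where "t j = (if j \<le> g then 2 * deriv (a j) x * F (Suc g - j) x else 0)" for j
  have hol: "B j (F n) holomorphic_on U" if "j \<le> g" for j n
    unfolding B_def using F U aU[OF that] by (intro holomorphic_intros) auto
  have A1: "A_op v g a f = (\<lambda>y. \<Sum>j=0..g. B j (F (g - j)) y)"
    by (simp add: A_op_def B_def F_def H_def)
  have A2: "A_op v g a (H f) = (\<lambda>y. \<Sum>j=0..g. B j (H (F (g - j))) y)"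
    by (simp add: A_op_def B_def F_def funpow_swap1 flip: H_def)
  have "A_op v g a (H f) x - H (A_op v g a f) x = (\<Sum>j=0..g. B j (H (F (g - j))) x - H (B j (F (g - j))) x)"
    unfolding A1 A2 unfolding H_def using hol
    by (subst schroedinger_op_sum[OF U(1) x]) (auto simp: sum_subtractf)
  also have "\<dots> = (\<Sum>j=0..g. t (Suc j) - t j)"
  proof (intro sum.cong refl)
    fix j assume "j \<in> {0..g}"
    then have j: "j \<le> g" by simp
    have "B j (H (F (g - j))) x - H (B j (F (g - j))) x =
            kdv_op v (a j) x / 2 * F (g - j) x - 2 * deriv (a j) x * F (Suc g - j) x"
      using schroedinger_op_first_order_commutator[OF U(1) vU aU[OF j] F x, of "g - j"] j HF[of "g - j"]
      unfolding B_def H_def by (simp add: Suc_diff_le)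
    also have "\<dots> = t (Suc j) - t j"
    proof (cases "j = g")
      case True
      then show ?thesis using stat[of x] x U by (auto simp: t_def)
    next
      case False
      then show ?thesis using rec[of j x] j x U by (auto simp: t_def)
    qed
    finally show "B j (H (F (g - j))) x - H (B j (F (g - j))) x = t (Suc j) - t j" .
  qed
  also have "\<dots> = t (Suc g) - t 0"
    by (simp only: atLeast0AtMost lessThan_Suc_atMost[symmetric] sum_lessThan_telescope)
  also have "\<dots> = 0" using a0[of x] x U by (auto simp: t_def)
  finally show "A_op v g a (schroedinger_op v f) x = schroedinger_op v (A_op v g a f) x"
    by (simp add: H_def)
qed

section \<open>Leading terms\<close>

text \<open>Models a differential operator of order less than \<open>m\<close>. Operators here act
  on arbitrary functions, so the representation is demanded only on locally defined holomorphic
  ones, with one family of coefficients for all of them. Holomorphy on \<open>S\<close> supports the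
  product rule, meromorphy on the plane is what \<open>finite_gap_potential\<close> asks
  for.\<close>

definition low_order_op ::
  "complex set \<Rightarrow> nat \<Rightarrow> ((complex \<Rightarrow> complex) \<Rightarrow> complex \<Rightarrow> complex) \<Rightarrow> bool" where
  "low_order_op S m P \<longleftrightarrow>
     (\<exists>c. (\<forall>i. c i meromorphic_on UNIV \<and> c i holomorphic_on S) \<and>
        (\<forall>U f x. open U \<and> U \<subseteq> S \<and> f holomorphic_on U \<and> x \<in> U \<longrightarrow>
           P f x = (\<Sum>i<m. c i x * (deriv ^^ i) f x)))"

lemma low_order_opE:
  assumes "low_order_op S m P"
  obtains c where "\<And>i. c i meromorphic_on UNIV \<and> c i holomorphic_on S"
    "\<And>U f x. open U \<and> U \<subseteq> S \<and> f holomorphic_on U \<and> x \<in> U \<Longrightarrow> P f x = (\<Sum>i<m. c i x * (deriv ^^ i) f x)"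
  using assms unfolding low_order_op_def by metis

lemma low_order_op_cong:
  assumes "low_order_op S m P"
    and "\<And>U f x. \<lbrakk>open U; U \<subseteq> S; f holomorphic_on U; x \<in> U\<rbrakk> \<Longrightarrow> Q f x = P f x"
  shows "low_order_op S m Q"
  using assms unfolding low_order_op_def by metis

lemma low_order_op_zero: "low_order_op S m (\<lambda>f x. 0)"
  unfolding low_order_op_def by (rule exI[of _ "\<lambda>i x. 0"]) (auto intro: meromorphic_intros)

lemma low_order_op_deriv_power:
  assumes "i < m"
  shows "low_order_op S m (\<lambda>f. (deriv ^^ i) f)"
  unfolding low_order_op_def
  by (rule exI[of _ "\<lambda>k x. if k = i then 1 else 0"])
     (use assms in \<open>auto intro: meromorphic_intros simp: if_distrib[of "\<lambda>a. a * _"] cong: if_cong\<close>)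

lemma low_order_op_mono:
  assumes "low_order_op S m P" "m \<le> n"
  shows "low_order_op S n P"
proof -
  obtain c where c: "\<And>i. c i meromorphic_on UNIV \<and> c i holomorphic_on S"
    "\<And>U f x. open U \<and> U \<subseteq> S \<and> f holomorphic_on U \<and> x \<in> U \<Longrightarrow> P f x = (\<Sum>i<m. c i x * (deriv ^^ i) f x)"
    by (rule low_order_opE[OF assms(1)]) (rule that)
  show ?thesis
    unfolding low_order_op_def
  proof (intro exI[of _ "\<lambda>i. if i < m then c i else (\<lambda>_. 0)"] conjI allI impI)
    fix U f x assume U: "open U \<and> U \<subseteq> S \<and> f holomorphic_on U \<and> x \<in> U"
    show "P f x = (\<Sum>i<n. (if i < m then c i else (\<lambda>_. 0)) x * (deriv ^^ i) f x)"
      unfolding c(2)[OF U] using assms(2) by (intro sum.mono_neutral_cong_left) auto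
  qed (use c in \<open>auto intro: meromorphic_intros\<close>)
qed

lemma low_order_op_add:
  assumes "low_order_op S m P" "low_order_op S m Q"
  shows "low_order_op S m (\<lambda>f x. P f x + Q f x)"
proof -
  obtain c where c: "\<And>i. c i meromorphic_on UNIV \<and> c i holomorphic_on S"
    "\<And>U f x. open U \<and> U \<subseteq> S \<and> f holomorphic_on U \<and> x \<in> U \<Longrightarrow> P f x = (\<Sum>i<m. c i x * (deriv ^^ i) f x)"
    by (rule low_order_opE[OF assms(1)]) (rule that)
  obtain d where d: "\<And>i. d i meromorphic_on UNIV \<and> d i holomorphic_on S"
    "\<And>U f x. open U \<and> U \<subseteq> S \<and> f holomorphic_on U \<and> x \<in> U \<Longrightarrow> Q f x = (\<Sum>i<m. d i x * (deriv ^^ i) f x)"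
    by (rule low_order_opE[OF assms(2)]) (rule that)
  show ?thesis
    unfolding low_order_op_def
    by (rule exI[of _ "\<lambda>i x. c i x + d i x"])
       (use c d in \<open>auto intro!: meromorphic_intros holomorphic_intros simp: sum.distrib algebra_simps\<close>)
qed

lemma low_order_op_mult:
  assumes "low_order_op S m P" "a meromorphic_on UNIV" "a holomorphic_on S"
  shows "low_order_op S m (\<lambda>f x. a x * P f x)"
proof -
  obtain c where c: "\<And>i. c i meromorphic_on UNIV \<and> c i holomorphic_on S"
    "\<And>U f x. open U \<and> U \<subseteq> S \<and> f holomorphic_on U \<and> x \<in> U \<Longrightarrow> P f x = (\<Sum>i<m. c i x * (deriv ^^ i) f x)"
    by (rule low_order_opE[OF assms(1)]) (rule that)
  show ?thesis
    unfolding low_order_op_def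
    by (rule exI[of _ "\<lambda>i x. a x * c i x"])
       (use c assms in \<open>auto intro!: meromorphic_intros holomorphic_intros simp: sum_distrib_left algebra_simps\<close>)
qed

lemma low_order_op_sum:
  assumes "finite J" "\<And>j. j \<in> J \<Longrightarrow> low_order_op S m (P j)"
  shows "low_order_op S m (\<lambda>f x. \<Sum>j\<in>J. P j f x)"
  using assms by (induction rule: finite_induct) (auto intro: low_order_op_zero low_order_op_add)

lemma low_order_op_deriv:
  assumes "low_order_op S m P" "open S"
  shows "low_order_op S (Suc m) (\<lambda>f. deriv (P f))"
proof -
  obtain c where c: "\<And>i. c i meromorphic_on UNIV \<and> c i holomorphic_on S"
    "\<And>U f x. open U \<and> U \<subseteq> S \<and> f holomorphic_on U \<and> x \<in> U \<Longrightarrow> P f x = (\<Sum>i<m. c i x * (deriv ^^ i) f x)"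
    by (rule low_order_opE[OF assms(1)]) (rule that)
  have "low_order_op S (Suc m) (\<lambda>f x. \<Sum>i<m. deriv (c i) x * (deriv ^^ i) f x + c i x * (deriv ^^ Suc i) f x)"
    using c \<open>open S\<close>
    by (intro low_order_op_sum low_order_op_add low_order_op_mult low_order_op_deriv_power)
       (auto intro!: meromorphic_intros holomorphic_intros)
  then show ?thesis
  proof (rule low_order_op_cong)
    fix U f x assume U: "open U" "U \<subseteq> S" and f: "f holomorphic_on U" and x: "x \<in> U"
    have "deriv (P f) x = deriv (\<lambda>x. \<Sum>i<m. c i x * (deriv ^^ i) f x) x"
      using c(2) U f x by (intro deriv_cong_ev) (auto simp: eventually_nhds)
    also have "\<dots> = (\<Sum>i<m. deriv (c i) x * (deriv ^^ i) f x + c i x * (deriv ^^ Suc i) f x)"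
    proof (intro DERIV_imp_deriv DERIV_sum)
      fix i
      have "(c i has_field_derivative deriv (c i) x) (at x)"
        using c(1)[of i] U x by (intro holomorphic_derivI[of _ U]) (auto intro: holomorphic_on_subset)
      moreover have "((deriv ^^ i) f has_field_derivative (deriv ^^ Suc i) f x) (at x)"
        unfolding funpow.simps o_def
        using U x f by (intro holomorphic_derivI[of _ U] holomorphic_higher_deriv) auto
      ultimately show "((\<lambda>y. c i y * (deriv ^^ i) f y) has_field_derivative
          deriv (c i) x * (deriv ^^ i) f x + c i x * (deriv ^^ Suc i) f x) (at x)"
        by (auto intro!: derivative_eq_intros)
    qed
    finally show "deriv (P f) x = \<dots>" .
  qed
qed

text \<open>The bound 2n - 1 says that the remainder has order at most 2n - 2: the term of order 2n
  - 1 is absent because H has no first-order term.\<close>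

lemma schroedinger_op_power_leading:
  assumes S: "open S" and v: "v meromorphic_on UNIV" "v holomorphic_on S"
  shows "low_order_op S (2 * n - 1) (\<lambda>f x. (schroedinger_op v ^^ n) f x - (-1) ^ n * (deriv ^^ (2 * n)) f x)"
proof (induction n)
  case 0
  show ?case by (simp add: low_order_op_zero)
next
  case (Suc n)
  define P where "P = (\<lambda>f x. (schroedinger_op v ^^ n) f x - (-1) ^ n * (deriv ^^ (2 * n)) f x)"
  have P: "low_order_op S (2 * n - 1) P" using Suc by (simp add: P_def)
  \<comment> \<open>For n = 0 truncated subtraction gives 2n - 1 = 0, and two derivatives would
    raise the bound to 2 instead of 1; there the remainder is zero.\<close>
  have ddP: "low_order_op S (2 * n + 1) (\<lambda>f. deriv (deriv (P f)))"
  proof (cases n)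
    case 0
    have "P = (\<lambda>f x. 0)" by (simp add: P_def 0)
    then show ?thesis by (simp add: low_order_op_zero)
  next
    case (Suc m)
    then show ?thesis using low_order_op_deriv[OF low_order_op_deriv[OF P S] S] by simp
  qed
  have "low_order_op S (2 * n + 1) (\<lambda>f x. (-1) * deriv (deriv (P f)) x + v x * (P f x + (-1) ^ n * (deriv ^^ (2 * n)) f x))"
    by (intro low_order_op_add low_order_op_mult ddP low_order_op_mono[OF P] low_order_op_deriv_power v)
       (auto intro: meromorphic_intros)
  then have "low_order_op S (2 * n + 1) (\<lambda>f x. (schroedinger_op v ^^ Suc n) f x - (-1) ^ Suc n * (deriv ^^ (2 * Suc n)) f x)"
  proof (rule low_order_op_cong)
    fix U f x assume U: "open U" "U \<subseteq> S" and f: "f holomorphic_on U" and x: "x \<in> U"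
    have h1: "(schroedinger_op v ^^ n) f holomorphic_on U"
      using v U f by (intro schroedinger_op_power_holomorphic) (auto intro: holomorphic_on_subset)
    have h2: "(deriv ^^ k) f holomorphic_on U" for k
      using f U by (intro holomorphic_higher_deriv)
    have h3: "P f holomorphic_on U"
      unfolding P_def by (intro holomorphic_intros h1 h2)
    have eq: "(schroedinger_op v ^^ n) f = (\<lambda>y. P f y + (-1) ^ n * (deriv ^^ (2 * n)) f y)"
      by (simp add: P_def)
    have d: "deriv (\<lambda>y. p y + (-1) ^ n * q y) y = deriv p y + (-1) ^ n * deriv q y"
      if "p holomorphic_on U" "q holomorphic_on U" "y \<in> U" for p q y
      using that U holomorphic_derivI[of p U y] holomorphic_derivI[of q U y]
      by (intro DERIV_imp_deriv) (auto intro!: derivative_eq_intros)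
    have "deriv (deriv ((schroedinger_op v ^^ n) f)) x =
       deriv (\<lambda>y. deriv (P f) y + (-1) ^ n * (deriv ^^ Suc (2 * n)) f y) x"
      unfolding eq using d[OF h3 h2] U x by (intro deriv_cong_ev) (auto simp: eventually_nhds)
    also have "\<dots> = deriv (deriv (P f)) x + (-1) ^ n * (deriv ^^ Suc (Suc (2 * n))) f x"
      using d[OF holomorphic_deriv[OF h3 U(1)] h2 x, of "Suc (2 * n)"] by simp
    finally have "deriv (deriv ((schroedinger_op v ^^ n) f)) x = \<dots>" .
    moreover have "(schroedinger_op v ^^ Suc n) f x = - deriv (deriv ((schroedinger_op v ^^ n) f)) x +
        v x * (P f x + (-1) ^ n * (deriv ^^ (2 * n)) f x)"
      by (simp add: schroedinger_op_def numeral_2_eq_2 P_def)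
    ultimately show "(schroedinger_op v ^^ Suc n) f x - (-1) ^ Suc n * (deriv ^^ (2 * Suc n)) f x =
        (-1) * deriv (deriv (P f)) x + v x * (P f x + (-1) ^ n * (deriv ^^ (2 * n)) f x)"
      by simp
  qed
  then show ?case by simp
qed

text \<open>Only j = 0 reaches order 2g + 1, and as a_0 = 1 it contributes nothing at order 2g. A
  summand with j at least 1 has order at most 2(g - j) + 1, hence below 2g. The gap at order 2g is
  the shape required of a finite-gap operator.\<close>

lemma A_op_leading:
  assumes S: "open S" and v: "v meromorphic_on UNIV" "v holomorphic_on S"
    and a: "\<And>j. j \<le> g \<Longrightarrow> a j meromorphic_on UNIV \<and> a j holomorphic_on S"
    and a0: "a 0 = (\<lambda>x. 1)"
  shows "low_order_op S (2 * g) (\<lambda>f x. A_op v g a f x - (-1) ^ g * (deriv ^^ (2 * g + 1)) f x)"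
proof -
  define H where "H n = (\<lambda>f. (schroedinger_op v ^^ n) f)" for n
  define P where "P n = (\<lambda>f x. (schroedinger_op v ^^ n) f x - (-1) ^ n * (deriv ^^ (2 * n)) f x)" for n
  have P: "low_order_op S (2 * n - 1) (P n)" for n
    unfolding P_def by (rule schroedinger_op_power_leading[OF S v])
  have H: "low_order_op S (2 * n + 1) (H n)" for n
  proof -
    have "low_order_op S (2 * n + 1) (\<lambda>f x. P n f x + (-1) ^ n * (deriv ^^ (2 * n)) f x)"
      by (intro low_order_op_add low_order_op_mono[OF P] low_order_op_mult low_order_op_deriv_power)
         (auto intro: meromorphic_intros)
    then show ?thesis by (simp add: P_def H_def)
  qed
  have dP: "low_order_op S (2 * g) (\<lambda>f. deriv (P g f))"
  proof (cases g)
    case 0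
    have "P g = (\<lambda>f x. 0)" by (simp add: P_def 0)
    then show ?thesis by (simp add: low_order_op_zero)
  next
    case (Suc n)
    then show ?thesis using low_order_op_deriv[OF P[of g] S] by simp
  qed
  have T: "low_order_op S (2 * g) (\<lambda>f x. a j x * deriv (H (g - j) f) x + (- 1 / 2 * deriv (a j) x) * H (g - j) f x)"
    if "j \<in> {1..g}" for j
    using that a[of j] S
    by (intro low_order_op_add low_order_op_mult low_order_op_mono[OF low_order_op_deriv[OF H S]]
          low_order_op_mono[OF H]) (auto intro!: meromorphic_intros holomorphic_intros)
  have "low_order_op S (2 * g) (\<lambda>f x. deriv (P g f) x + (\<Sum>j=1..g. a j x * deriv (H (g - j) f) x + (- 1 / 2 * deriv (a j) x) * H (g - j) f x))"
    by (intro low_order_op_add dP low_order_op_sum T) auto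
  then show ?thesis
  proof (rule low_order_op_cong)
    fix U f x assume U: "open U" "U \<subseteq> S" and f: "f holomorphic_on U" and x: "x \<in> U"
    have h1: "H g f holomorphic_on U"
      using v U f unfolding H_def by (intro schroedinger_op_power_holomorphic) (auto intro: holomorphic_on_subset)
    have h2: "(deriv ^^ (2 * g)) f holomorphic_on U"
      using f U by (intro holomorphic_higher_deriv)
    have "deriv (P g f) x = deriv (H g f) x - (-1) ^ g * (deriv ^^ (2 * g + 1)) f x"
      using holomorphic_derivI[OF h1 U(1) x] holomorphic_derivI[OF h2 U(1) x]
      unfolding P_def H_def by (intro DERIV_imp_deriv) (auto intro!: derivative_eq_intros)
    moreover have "A_op v g a f x = deriv (H g f) x + (\<Sum>j=1..g. a j x * deriv (H (g - j) f) x + (- 1 / 2 * deriv (a j) x) * H (g - j) f x)"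
      unfolding A_op_def by (simp add: sum.atLeast_Suc_atMost[of 0] a0 H_def)
    ultimately show "A_op v g a f x - (-1) ^ g * (deriv ^^ (2 * g + 1)) f x =
      deriv (P g f) x + (\<Sum>j=1..g. a j x * deriv (H (g - j) f) x + (- 1 / 2 * deriv (a j) x) * H (g - j) f x)"
      by simp
  qed
qed

section \<open>Preservation of the pole order\<close>

text \<open>The bounds \<open>a\<close> and \<open>b\<close> may lie below the true subdegrees, so a
  single summation range remains valid when leading coefficients happen to vanish.\<close>

lemma fls_times_nth_bounds:
  fixes F G :: "'a::comm_ring_1 fls"
  assumes "\<And>i. i < a \<Longrightarrow> F $$ i = 0" "\<And>i. i < b \<Longrightarrow> G $$ i = 0"
  shows "(F * G) $$ n = (\<Sum>i=a..n-b. F $$ i * G $$ (n - i))"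
proof -
  have "F $$ i * G $$ (n - i) = 0" if "i < fls_subdegree F \<or> n - fls_subdegree G < i \<or> i < a \<or> n - b < i" for i
    using that assms by (auto simp: fls_eq0_below_subdegree)
  then show ?thesis
    unfolding fls_times_nth(2)
    by (intro sum.mono_neutral_cong) (auto simp: not_le)
qed

text \<open>In the coefficient of order t - 1 of the recursion, all products V_i F_(t-i) vanish
  except the one from the double pole i = -2. Hence 4 t G_t is an explicit multiple of F_(t+2), and
  t is nonzero because both alternatives for t make it negative.\<close>

lemma gelfand_dikii_pole_step:
  fixes V F G :: "complex fls" and l :: nat
  assumes V2: "V $$ (-2) = of_nat (l * (l + 1))"
    and Vlow: "\<And>i. i < -2 \<Longrightarrow> V $$ i = 0"
    and Vodd: "\<And>i. odd i \<Longrightarrow> i < 2 * int l \<Longrightarrow> V $$ i = 0"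
    and Flow: "\<And>i. i < - 2 * int l \<Longrightarrow> F $$ i = 0"
    and Fodd: "\<And>i. odd i \<Longrightarrow> i < 0 \<Longrightarrow> F $$ i = 0"
    and eq: "4 * fls_deriv G = 4 * V * fls_deriv F + 2 * fls_deriv V * F - fls_deriv (fls_deriv (fls_deriv F))"
    and t: "t < - 2 * int l \<or> odd t \<and> t < 0"
  shows "G $$ t = 0"
proof -
  have "(4 * V * fls_deriv F + 2 * fls_deriv V * F) $$ (t - 1) =
        4 * (\<Sum>i=-2..t+2*int l. V $$ i * (of_int (t - i) * F $$ (t - i))) +
        2 * (\<Sum>i=-3..t-1+2*int l. of_int (i+1) * V $$ (i+1) * F $$ (t - 1 - i))"
  proof -
    have "(V * fls_deriv F) $$ (t - 1) = (\<Sum>i=-2..t+2*int l. V $$ i * (of_int (t - i) * F $$ (t - i)))"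
      by (subst fls_times_nth_bounds[where a = "-2" and b = "- 2 * int l - 1"])
         (use Vlow Flow in \<open>auto simp: algebra_simps intro!: sum.cong\<close>)
    moreover have "(fls_deriv V * F) $$ (t - 1) = (\<Sum>i=-3..t-1+2*int l. of_int (i+1) * V $$ (i+1) * F $$ (t - 1 - i))"
      by (subst fls_times_nth_bounds[where a = "-3" and b = "- 2 * int l"])
         (use Vlow Flow in \<open>auto simp: algebra_simps intro!: sum.cong\<close>)
    ultimately show ?thesis
      by (simp add: mult.assoc fls_mult_of_numeral_nth)
  qed
  also have "(\<Sum>i=-3..t-1+2*int l. of_int (i+1) * V $$ (i+1) * F $$ (t - 1 - i)) =
             (\<Sum>i=-2..t+2*int l. of_int i * V $$ i * F $$ (t - i))"
    by (rule sum.reindex_bij_witness[where i = "\<lambda>i. i - 1" and j = "\<lambda>i. i + 1"])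
       (auto simp: algebra_simps)
  also have "4 * (\<Sum>i=-2..t+2*int l. V $$ i * (of_int (t - i) * F $$ (t - i))) + 2 * \<dots> =
             (\<Sum>i=-2..t+2*int l. of_int (4 * t - 2 * i) * V $$ i * F $$ (t - i))"
    by (simp add: sum_distrib_left algebra_simps flip: sum.distrib)
  also have "\<dots> = (\<Sum>i\<in>{-2..t+2*int l} \<inter> {-2}. of_int (4 * t - 2 * i) * V $$ i * F $$ (t - i))"
  proof (rule sum.mono_neutral_right)
    show "\<forall>i\<in>{-2..t+2*int l} - {-2..t+2*int l} \<inter> {-2}. of_int (4 * t - 2 * i) * V $$ i * F $$ (t - i) = 0"
    proof
      fix i assume i: "i \<in> {-2..t+2*int l} - {-2..t+2*int l} \<inter> {-2}"
      then have "i \<ge> -1" by auto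
      show "of_int (4 * t - 2 * i) * V $$ i * F $$ (t - i) = 0"
      \<comment> \<open>An odd i below 2l kills V_i, while i at least 2l pushes t - i below -2l
        since t < 0. An even i at least 0 keeps t - i in the range of orders where F
        vanishes.\<close>
      proof (cases "odd i")
        case True
        then have "V $$ i = 0 \<or> F $$ (t - i) = 0"
          using i t \<open>i \<ge> -1\<close> by (cases "i < 2 * int l") (auto intro!: Vodd Flow)
        then show ?thesis by auto
      next
        case False
        then have "i \<ge> 0" using \<open>i \<ge> -1\<close> by (cases "i = -1") auto
        then have "F $$ (t - i) = 0" using t False by (cases "t < - 2 * int l") (auto intro: Flow Fodd)
        then show ?thesis by simp
      qed
    qed
  qed auto
  also have "\<dots> = of_int (4 * t + 4) * (of_nat (l * (l + 1)) * F $$ (t + 2))"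
    using Flow[of "t + 2"] by (cases "-2 \<le> t + 2 * int l") (auto simp: V2)
  finally have main: "(4 * V * fls_deriv F + 2 * fls_deriv V * F) $$ (t - 1) =
      of_int (4 * t + 4) * (of_nat (l * (l + 1)) * F $$ (t + 2))" .
  have "4 * of_int t * G $$ t = (4 * fls_deriv G) $$ (t - 1)"
    by (simp add: fls_mult_of_numeral_nth)
  also have "\<dots> = of_int (4 * t + 4) * (of_nat (l * (l + 1)) * F $$ (t + 2)) -
      of_int (t * (t + 1) * (t + 2)) * F $$ (t + 2)"
    unfolding eq fls_minus_nth main by (simp add: algebra_simps)
  also have "\<dots> = of_int ((t + 1) * (4 * (int l * (int l + 1)) - t * (t + 2))) * F $$ (t + 2)"
    by (simp add: algebra_simps)
  also have "\<dots> = 0"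
  \<comment> \<open>The integer factor is -(t+1)(t-2l)(t+2l+2). Its negative zeros are exactly the
    two admissible t for which t + 2 may leave the vanishing range of F: t + 2 = 1 and t + 2 =
    -2l.\<close>
  proof (cases "t = - 1 \<or> t = - 2 * int l - 2")
    case True
    then have "(t + 1) * (4 * (int l * (int l + 1)) - t * (t + 2)) = 0"
      by (elim disjE) (simp_all only:, simp_all add: algebra_simps)
    then show ?thesis by (simp only: of_int_0 mult_zero_left)
  next
    case False
    then have "t + 2 < - 2 * int l \<or> odd (t + 2) \<and> t + 2 < 0"
      using t by presburger
    then have "F $$ (t + 2) = 0" using Flow Fodd by auto
    then show ?thesis by simp
  qed
  finally show ?thesis using t by auto
qed

section \<open>Period lattices\<close>

text \<open>The exponent is half of the 3 in the lattice sum below: the double sum is dominated by a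
  product of two such series, and 3/2 > 1.\<close>

lemma summable_on_int_powr:
  "(\<lambda>m::int. (1 + \<bar>real_of_int m\<bar>) powr (-3/2)) summable_on UNIV"
proof -
  let ?f = "\<lambda>m::int. (1 + \<bar>real_of_int m\<bar>) powr (-3/2)"
  have "summable (\<lambda>n. real (Suc n) powr (-3/2))"
    using summable_Suc_iff[of "\<lambda>n. real n powr (-3/2)"] by (simp add: summable_real_powr_iff)
  then have s: "(\<lambda>n. real (Suc n) powr (-3/2)) summable_on UNIV"
    by (subst summable_on_UNIV_nonneg_real_iff) auto
  have 1: "?f summable_on range int"
    using s by (subst summable_on_reindex) (auto simp: o_def add.commute)
  have "?f summable_on range (\<lambda>n. - int n)"
    using s by (subst summable_on_reindex) (auto simp: o_def add.commute inj_on_def)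
  then have 2: "?f summable_on range (\<lambda>n. - int n) - range int"
    by (rule summable_on_subset_banach) auto
  have "UNIV = range int \<union> (range (\<lambda>n. - int n) - range int)"
    by (auto simp: image_iff) (metis int_cases2)
  then show ?thesis using summable_on_Un_disjoint[OF 1 2] by auto
qed

text \<open>Up to sign the hypothesis concerns the real determinant of the pair, which is the
  denominator in Cramer's rule and in the norm estimate below.\<close>

locale lattice_basis =
  fixes \<omega>1 \<omega>3 :: complex
  assumes nondegenerate: "Im (\<omega>1 * cnj \<omega>3) \<noteq> 0"
begin

abbreviation "\<Lambda> \<equiv> period_lattice \<omega>1 \<omega>3"

lemma lattice_iff: "w \<in> \<Lambda> \<longleftrightarrow> (\<exists>m n. w = 2 * of_int m * \<omega>1 + 2 * of_int n * \<omega>3)"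
  by (auto simp: period_lattice_def)

lemma lattice_0 [simp, intro]: "0 \<in> \<Lambda>"
  unfolding lattice_iff by (rule exI[of _ 0], rule exI[of _ 0]) simp

lemma lattice_add [intro]: "w \<in> \<Lambda> \<Longrightarrow> w' \<in> \<Lambda> \<Longrightarrow> w + w' \<in> \<Lambda>"
  unfolding lattice_iff
  by (elim exE, rule_tac x = "m + ma" in exI, rule_tac x = "n + na" in exI) (auto simp: algebra_simps)

lemma lattice_minus [intro]: "w \<in> \<Lambda> \<Longrightarrow> - w \<in> \<Lambda>"
  unfolding lattice_iff
  by (elim exE, rule_tac x = "-m" in exI, rule_tac x = "-n" in exI) (auto simp: algebra_simps)

lemma lattice_minus_iff [simp]: "- w \<in> \<Lambda> \<longleftrightarrow> w \<in> \<Lambda>"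
  using lattice_minus[of w] lattice_minus[of "- w"] by auto

lemma lattice_diff [intro]: "w \<in> \<Lambda> \<Longrightarrow> w' \<in> \<Lambda> \<Longrightarrow> w - w' \<in> \<Lambda>"
  using lattice_add[of w "- w'"] by auto

lemma lattice_add_iff [simp]: "p \<in> \<Lambda> \<Longrightarrow> w + p \<in> \<Lambda> \<longleftrightarrow> w \<in> \<Lambda>"
  using lattice_diff[of "w + p" p] by auto

lemma lattice_periods: "2 * \<omega>1 \<in> \<Lambda>" "2 * \<omega>3 \<in> \<Lambda>"
  unfolding lattice_iff by (rule exI[of _ 1], rule exI[of _ 0], simp) (rule exI[of _ 0], rule exI[of _ 1], simp)

lemma real_coordinates: "\<exists>x y::real. z = of_real x * \<omega>1 + of_real y * \<omega>3"
proof -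
  define d where "d = Im (\<omega>1 * cnj \<omega>3)"
  define p q where "p = Im (z * cnj \<omega>3)" and "q = Im (z * cnj \<omega>1)"
  have "d \<noteq> 0" using nondegenerate by (simp add: d_def)
  moreover have "d * Re z = p * Re \<omega>1 - q * Re \<omega>3" "d * Im z = p * Im \<omega>1 - q * Im \<omega>3"
    by (simp_all add: d_def p_def q_def algebra_simps)
  ultimately have "z = of_real (p / d) * \<omega>1 + of_real (- q / d) * \<omega>3"
    by (auto simp: complex_eq_iff field_simps)
  then show ?thesis by blast
qed

text \<open>Multiplying by \<open>cnj \<omega>3\<close> and taking imaginary parts isolates x, and
  \<open>cnj \<omega>1\<close> isolates y; adding the two estimates gives the explicit constant d /
  K.\<close>

lemma norm_lower_bound:
  obtains c where "c > 0" "\<And>x y::real. c * (\<bar>x\<bar> + \<bar>y\<bar>) \<le> norm (of_real x * \<omega>1 + of_real y * \<omega>3)"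
proof -
  define d where "d = \<bar>Im (\<omega>1 * cnj \<omega>3)\<bar>"
  have d: "d > 0" using nondegenerate by (simp add: d_def)
  define K where "K = norm \<omega>1 + norm \<omega>3"
  have K: "K > 0"
    using nondegenerate by (auto simp: K_def add_nonneg_eq_0_iff less_le)
  have "d / K * (\<bar>x\<bar> + \<bar>y\<bar>) \<le> norm (of_real x * \<omega>1 + of_real y * \<omega>3)" for x y :: real
  proof -
    define w where "w = of_real x * \<omega>1 + of_real y * \<omega>3"
    have "\<bar>x\<bar> * d = \<bar>Im (w * cnj \<omega>3)\<bar>"
      by (simp add: w_def d_def algebra_simps flip: abs_mult)
    also have "\<dots> \<le> norm w * norm \<omega>3"
      by (metis abs_Im_le_cmod complex_mod_cnj norm_mult)
    finally have 1: "\<bar>x\<bar> * d \<le> norm w * norm \<omega>3" .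
    have "\<bar>y\<bar> * d = \<bar>Im (w * cnj \<omega>1)\<bar>"
      by (simp add: w_def d_def algebra_simps flip: abs_mult) 
    also have "\<dots> \<le> norm w * norm \<omega>1"
      by (metis abs_Im_le_cmod complex_mod_cnj norm_mult)
    finally have "(\<bar>x\<bar> + \<bar>y\<bar>) * d \<le> norm w * K"
      using 1 by (simp add: K_def algebra_simps)
    then show ?thesis using K by (simp add: field_simps w_def)
  qed
  then show ?thesis using d K by (intro that[of "d / K"]) auto
qed

lemma finite_lattice_cball: "finite {w \<in> \<Lambda>. norm w \<le> R}"
proof -
  obtain c where c: "c > 0" "\<And>x y::real. c * (\<bar>x\<bar> + \<bar>y\<bar>) \<le> norm (of_real x * \<omega>1 + of_real y * \<omega>3)"
    using norm_lower_bound by blast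
  define N where "N = \<lceil>R / c\<rceil>"
  have "{w \<in> \<Lambda>. norm w \<le> R} \<subseteq> (\<lambda>(m, n). 2 * of_int m * \<omega>1 + 2 * of_int n * \<omega>3) ` ({-N..N} \<times> {-N..N})"
  proof
    fix w assume "w \<in> {w \<in> \<Lambda>. norm w \<le> R}"
    then obtain m n where w: "w = 2 * of_int m * \<omega>1 + 2 * of_int n * \<omega>3" "norm w \<le> R"
      by (auto simp: lattice_iff)
    have "c * (\<bar>real_of_int (2 * m)\<bar> + \<bar>real_of_int (2 * n)\<bar>) \<le> R"
      using c(2)[of "of_int (2 * m)" "of_int (2 * n)"] w by simp
    then have "\<bar>real_of_int (2 * m)\<bar> + \<bar>real_of_int (2 * n)\<bar> \<le> R / c"
      using c(1) by (simp add: field_simps)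
    then have "real_of_int \<bar>m\<bar> \<le> R / c" "real_of_int \<bar>n\<bar> \<le> R / c" by (auto simp: abs_if split: if_splits)
    then have "\<bar>m\<bar> \<le> N" "\<bar>n\<bar> \<le> N" unfolding N_def by linarith+
    then show "w \<in> (\<lambda>(m, n). 2 * of_int m * \<omega>1 + 2 * of_int n * \<omega>3) ` ({-N..N} \<times> {-N..N})"
      using w by (auto simp: abs_le_iff)
  qed
  then show ?thesis by (rule finite_subset) auto
qed

lemma lattice_not_islimpt: "\<not> z islimpt \<Lambda>"
proof
  assume "z islimpt \<Lambda>"
  then have "z islimpt (\<Lambda> \<inter> ball z 1)" by (rule islimpt_Int_eventually) (rule eventually_at_in_open', auto)
  moreover have "finite (\<Lambda> \<inter> ball z 1)"
    by (rule finite_subset[OF _ finite_lattice_cball[of "norm z + 1"]])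
       (auto simp: dist_norm norm_minus_commute intro: order.trans[OF norm_triangle_sub[of _ z]])
  ultimately show False using islimpt_finite by blast
qed

text \<open>With q = |m| + |n| at least 1, one has (1 + |m|)(1 + |n|) <= (2q)^2, while the norm of
  the lattice point is at least 2 c q; raising to the power 3/2 separates m from n. The origin
  contributes 0 because 1 / 0 = 0.\<close>

lemma summable_on_lattice_inverse_cube: "(\<lambda>w. 1 / norm w ^ 3) summable_on \<Lambda>"
proof -
  let ?f = "\<lambda>m::int. (1 + \<bar>real_of_int m\<bar>) powr (-3/2)"
  let ?w = "\<lambda>(m, n). 2 * complex_of_int m * \<omega>1 + 2 * of_int n * \<omega>3"
  obtain c where c: "c > 0" "\<And>x y::real. c * (\<bar>x\<bar> + \<bar>y\<bar>) \<le> norm (of_real x * \<omega>1 + of_real y * \<omega>3)"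
    using norm_lower_bound by blast
  have "(\<lambda>(m, n). ?f m * ?f n) summable_on UNIV \<times> UNIV"
  proof (rule summable_on_SigmaI)
    fix m :: int
    show "((\<lambda>n. case (m, n) of (m, n) \<Rightarrow> ?f m * ?f n) has_sum ?f m * infsum ?f UNIV) UNIV"
      using summable_on_int_powr by (auto intro!: has_sum_cmult_right)
  qed (use summable_on_int_powr in \<open>auto intro!: summable_on_cmult_left\<close>)
  then have s: "(\<lambda>p. 1 / c ^ 3 * (case p of (m, n) \<Rightarrow> ?f m * ?f n)) summable_on UNIV"
    by (intro summable_on_cmult_right) auto
  have "(\<lambda>p. 1 / norm (?w p) ^ 3) summable_on UNIV"
  proof (rule summable_on_comparison_test[OF s])
    fix p :: "int \<times> int"
    obtain m n where p: "p = (m, n)" by force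
    show "1 / norm (?w p) ^ 3 \<le> 1 / c ^ 3 * (case p of (m, n) \<Rightarrow> ?f m * ?f n)"
    proof (cases "m = 0 \<and> n = 0")
      case True
      then show ?thesis using c by (simp add: p)
    next
      case False
      then have "\<bar>m\<bar> + \<bar>n\<bar> \<ge> 1" by auto
      then have mn: "\<bar>real_of_int m\<bar> + \<bar>real_of_int n\<bar> \<ge> 1" by linarith
      define u where "u = (1 + \<bar>real_of_int m\<bar>) * (1 + \<bar>real_of_int n\<bar>)"
      have u: "u \<ge> 1" by (simp add: u_def algebra_simps)
      define q where "q = \<bar>real_of_int m\<bar> + \<bar>real_of_int n\<bar>"
      have q: "q \<ge> 1" using mn by (simp add: q_def)
      have "\<bar>real_of_int m\<bar> \<le> q" "\<bar>real_of_int n\<bar> \<le> q" by (auto simp: q_def)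
      then have "u \<le> (1 + q) * (1 + q)" unfolding u_def by (intro mult_mono) auto
      also have "\<dots> \<le> (2 * q) ^ 2" unfolding power2_eq_square using q by (intro mult_mono) auto
      finally have "u powr (3/2) \<le> ((2 * q) ^ 2) powr (3/2)" using u by (intro powr_mono2) auto
      also have "\<dots> = (2 * q) ^ 3"
      proof -
        have "2 * q \<ge> 0" using q by simp
        from powr_numeral[OF this, symmetric] show ?thesis by (simp only: powr_powr) simp
      qed
      finally have "c ^ 3 * u powr (3/2) \<le> (c * (2 * q)) ^ 3"
        using c(1) unfolding power_mult_distrib[of c] by simp
      also have "\<dots> \<le> norm (?w p) ^ 3"
        using c(1) q c(2)[of "of_int (2 * m)" "of_int (2 * n)"]
        by (intro power_mono) (auto simp: p q_def algebra_simps)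
      finally have "1 / norm (?w p) ^ 3 \<le> 1 / (c ^ 3 * u powr (3/2))"
        using c(1) u by (intro frac_le) auto
      also have "\<dots> = 1 / c ^ 3 * (case p of (m, n) \<Rightarrow> ?f m * ?f n)"
        by (simp add: p u_def powr_minus_divide powr_mult)
      finally show ?thesis .
    qed
  qed auto
  moreover have "inj ?w"
  proof (rule injI, clarify)
    fix m n m' n' :: int
    assume "2 * of_int m * \<omega>1 + 2 * of_int n * \<omega>3 = 2 * of_int m' * \<omega>1 + 2 * of_int n' * \<omega>3"
    then have "norm (of_real (of_int (2 * (m - m'))) * \<omega>1 + of_real (of_int (2 * (n - n'))) * \<omega>3) = 0"
      by (simp add: algebra_simps)
    then have "c * (\<bar>real_of_int (2 * (m - m'))\<bar> + \<bar>real_of_int (2 * (n - n'))\<bar>) \<le> 0"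
      using c(2)[of "of_int (2 * (m - m'))" "of_int (2 * (n - n'))"] by simp
    then have "\<bar>real_of_int (2 * (m - m'))\<bar> + \<bar>real_of_int (2 * (n - n'))\<bar> \<le> 0"
      using c(1) by (simp add: mult_le_0_iff)
    then have "real_of_int (2 * (m - m')) = 0" "real_of_int (2 * (n - n')) = 0" by linarith+
    then show "m = m' \<and> n = n'" by simp
  qed
  ultimately have "(\<lambda>w. 1 / norm w ^ 3) summable_on range ?w"
    by (subst summable_on_reindex) (auto simp: o_def)
  moreover have "range ?w = \<Lambda>" by (auto simp: period_lattice_def)
  ultimately show ?thesis by simp
qed

end

section \<open>The Weierstrass function\<close>

definition wp_term :: "complex \<Rightarrow> complex \<Rightarrow> complex" where
  "wp_term z w = 1 / (z - w) ^ 2 - 1 / w ^ 2"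

text \<open>The subtracted 1 / w^2 improves the decay from order 2 to order 3, since the difference
  is z (2w - z) / (w^2 (z - w)^2). The constant is 10 = (5/2) / (1/2)^2, from |2w - z| <= 5/2 |w|
  and |z - w| >= |w| / 2.\<close>

lemma wp_term_bound:
  assumes "norm z \<le> R" "2 * R < norm w"
  shows "norm (wp_term z w) \<le> 10 * R * (1 / norm w ^ 3)"
proof -
  have R: "R \<ge> 0" using assms(1) norm_ge_zero order_trans by blast
  then have w: "norm w > 0" using assms by linarith
  have zw: "norm (z - w) \<ge> norm w / 2"
    using norm_triangle_ineq2[of w z] assms by (simp add: norm_minus_commute)
  then have "z - w \<noteq> 0" "w \<noteq> 0" using w by auto
  then have "wp_term z w = z * (2 * w - z) / (w ^ 2 * (z - w) ^ 2)"
    unfolding wp_term_def by (simp add: field_simps) (simp add: algebra_simps power2_eq_square)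
  then have "norm (wp_term z w) = norm z * norm (2 * w - z) / (norm w ^ 2 * norm (z - w) ^ 2)"
    by (simp add: norm_mult norm_divide norm_power)
  also have "\<dots> \<le> (R * (5 / 2 * norm w)) / (norm w ^ 2 * (norm w / 2) ^ 2)"
  proof (intro frac_le mult_mono power_mono)
    show "norm (2 * w - z) \<le> 5 / 2 * norm w"
      using norm_triangle_ineq4[of "2 * w" z] assms by (simp add: norm_mult)
  qed (use assms R w zw in auto)
  also have "\<dots> = 10 * R * (1 / norm w ^ 3)"
    using w by (simp add: field_simps power2_eq_square power3_eq_cube)
  finally show ?thesis .
qed

context lattice_basis
begin

lemma wp_term_summable:
  assumes "B \<subseteq> \<Lambda>"
  shows "wp_term z summable_on B"
proof -
  let ?F = "{w \<in> \<Lambda>. norm w \<le> 2 * norm z}"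
  have "(\<lambda>w. norm (wp_term z w)) summable_on (\<Lambda> - ?F)"
  proof (rule Infinite_Sum.abs_summable_on_comparison_test')
    show "(\<lambda>w. 10 * norm z * (1 / norm w ^ 3)) summable_on (\<Lambda> - ?F)"
      by (intro summable_on_cmult_right summable_on_subset_banach[OF summable_on_lattice_inverse_cube]) auto
  qed (rule wp_term_bound, auto)
  then have "wp_term z summable_on (\<Lambda> - ?F)"
    by (rule abs_summable_summable)
  moreover have "wp_term z summable_on ?F"
    by (intro summable_on_finite finite_lattice_cball)
  ultimately have "wp_term z summable_on (?F \<union> (\<Lambda> - ?F))"
    by (intro summable_on_Un_disjoint) auto
  then show ?thesis
    by (rule summable_on_subset_banach) (use assms in auto)
qed

text \<open>Finitely many points of \<open>B\<close> lie within 2R of the origin, and these terms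
  are analytic at z since z is not in \<open>B\<close>. The rest converges uniformly on the disc of
  radius R = |z| + 1 by the M-test. A general \<open>B\<close> allows the pole at 0 to be left
  out.\<close>

lemma wp_tail_analytic:
  assumes "B \<subseteq> \<Lambda>" "z \<notin> B"
  shows "(\<lambda>z. \<Sum>\<^sub>\<infinity>w\<in>B. wp_term z w) analytic_on {z}"
proof -
  define R where "R = norm z + 1"
  let ?F = "{w \<in> B. norm w \<le> 2 * R}"
  have fin: "finite ?F"
    by (rule finite_subset[OF _ finite_lattice_cball[of "2 * R"]]) (use assms in auto)
  have ulim: "uniform_limit (cball 0 R) (\<lambda>X y. \<Sum>w\<in>X. wp_term y w) (\<lambda>y. \<Sum>\<^sub>\<infinity>w\<in>B - ?F. wp_term y w)
          (finite_subsets_at_top (B - ?F))"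
  proof (rule Weierstrass_m_test_general)
    show "(\<lambda>w. 10 * R * (1 / norm w ^ 3)) summable_on (B - ?F)"
      by (intro summable_on_cmult_right summable_on_subset_banach[OF summable_on_lattice_inverse_cube]) (use assms in auto)
  qed (rule wp_term_bound, auto)
  have ev: "\<forall>\<^sub>F X in finite_subsets_at_top (B - ?F).
      continuous_on (cball 0 R) (\<lambda>y. \<Sum>w\<in>X. wp_term y w) \<and> (\<lambda>y. \<Sum>w\<in>X. wp_term y w) holomorphic_on ball 0 R"
  proof (rule eventually_finite_subsets_at_top_weakI)
    fix X assume X: "finite X" "X \<subseteq> B - ?F"
    have ne: "y - w \<noteq> 0" if "w \<in> X" "norm y \<le> R" for y w
    proof -
      have "norm w > 2 * R" using X that(1) by auto
      moreover have "R > 0" by (simp add: R_def add_nonneg_pos)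
      ultimately show ?thesis using that(2) by auto
    qed
    have "(\<lambda>y. \<Sum>w\<in>X. wp_term y w) holomorphic_on cball 0 R"
      unfolding wp_term_def using ne by (intro holomorphic_intros) auto
    then show "continuous_on (cball 0 R) (\<lambda>y. \<Sum>w\<in>X. wp_term y w) \<and> (\<lambda>y. \<Sum>w\<in>X. wp_term y w) holomorphic_on ball 0 R"
      using holomorphic_on_imp_continuous_on holomorphic_on_subset ball_subset_cball by blast
  qed
  have "(\<lambda>y. \<Sum>\<^sub>\<infinity>w\<in>B - ?F. wp_term y w) holomorphic_on ball 0 R"
    by (rule holomorphic_uniform_limit[OF ev ulim finite_subsets_at_top_neq_bot])
  then have "(\<lambda>y. \<Sum>\<^sub>\<infinity>w\<in>B - ?F. wp_term y w) analytic_on {z}"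
    by (intro holomorphic_on_imp_analytic_at[of _ "ball 0 R"]) (auto simp: R_def)
  moreover have "(\<lambda>y. \<Sum>w\<in>?F. wp_term y w) analytic_on {z}"
    unfolding wp_term_def using assms by (intro analytic_intros) auto
  ultimately have "(\<lambda>y. (\<Sum>w\<in>?F. wp_term y w) + (\<Sum>\<^sub>\<infinity>w\<in>B - ?F. wp_term y w)) analytic_on {z}"
    by (rule analytic_on_add[rotated])
  also have "(\<lambda>y. (\<Sum>w\<in>?F. wp_term y w) + (\<Sum>\<^sub>\<infinity>w\<in>B - ?F. wp_term y w)) = (\<lambda>y. \<Sum>\<^sub>\<infinity>w\<in>B. wp_term y w)"
  proof
    fix y
    have "(\<Sum>\<^sub>\<infinity>w\<in>?F \<union> (B - ?F). wp_term y w) = (\<Sum>\<^sub>\<infinity>w\<in>?F. wp_term y w) + (\<Sum>\<^sub>\<infinity>w\<in>B - ?F. wp_term y w)"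
      using assms by (intro infsum_Un_disjoint wp_term_summable) auto
    moreover have "?F \<union> (B - ?F) = B" by auto
    ultimately show "(\<Sum>w\<in>?F. wp_term y w) + (\<Sum>\<^sub>\<infinity>w\<in>B - ?F. wp_term y w) = (\<Sum>\<^sub>\<infinity>w\<in>B. wp_term y w)"
      using fin by simp
  qed
  finally show ?thesis .
qed

abbreviation weierstrass (\<open>\<wp>\<close>) where "\<wp> \<equiv> wp \<omega>1 \<omega>3"

text \<open>The regular part of \<wp> at the origin. Through periodicity it supplies the expansion
  of \<wp> at every lattice point.\<close>

definition wp_reg :: "complex \<Rightarrow> complex" where
  "wp_reg z = (\<Sum>\<^sub>\<infinity>w\<in>\<Lambda> - {0}. wp_term z w)"

lemma wp_eq_reg: "\<wp> z = 1 / z ^ 2 + wp_reg z"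
  by (simp add: wp_def wp_reg_def wp_term_def)

lemma wp_reg_analytic: "wp_reg analytic_on {0}"
  unfolding wp_reg_def[abs_def] by (rule wp_tail_analytic) auto

lemma wp_analytic:
  assumes "z \<notin> \<Lambda>"
  shows "\<wp> analytic_on {z}"
proof -
  have "z \<noteq> 0" using assms by auto
  then have "(\<lambda>z. 1 / z ^ 2 + wp_reg z) analytic_on {z}"
    unfolding wp_reg_def using assms by (intro analytic_intros wp_tail_analytic) auto
  then show ?thesis by (simp flip: wp_eq_reg)
qed

text \<open>Since \<open>1 / 0 = 0\<close>, the term of the lattice point \<open>0\<close> is \<open>1 / z\<^sup>2\<close>.\<close>

lemma wp_eq_infsum: "\<wp> z = (\<Sum>\<^sub>\<infinity>w\<in>\<Lambda>. wp_term z w)"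
proof -
  have "(\<Sum>\<^sub>\<infinity>w\<in>{0} \<union> (\<Lambda> - {0}). wp_term z w) = (\<Sum>\<^sub>\<infinity>w\<in>{0}. wp_term z w) + (\<Sum>\<^sub>\<infinity>w\<in>\<Lambda> - {0}. wp_term z w)"
    by (intro infsum_Un_disjoint wp_term_summable) auto
  moreover have "{0} \<union> (\<Lambda> - {0}) = \<Lambda>" by auto
  ultimately show ?thesis by (simp add: wp_eq_reg wp_reg_def wp_term_def)
qed

lemma wp_term_minus: "wp_term (- z) (- w) = wp_term z w"
  by (simp add: wp_term_def) (simp add: power2_commute)

lemma wp_reg_minus: "wp_reg (- z) = wp_reg z"
  unfolding wp_reg_def
  by (rule infsum_reindex_bij_witness[where i = uminus and j = uminus]) (auto simp: wp_term_minus[of z, symmetric])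

lemma wp_minus: "\<wp> (- z) = \<wp> z"
  by (simp add: wp_eq_reg wp_reg_minus)

text \<open>
  Reindexing the sum for \<open>z + p\<close> by \<open>w + p\<close> shows that \<open>\<wp> (z + p) - \<wp> z\<close> does not depend on \<open>z\<close>;
  at \<open>z = - p / 2\<close> it vanishes because \<open>\<wp>\<close> is even.
\<close>

lemma wp_periodic:
  assumes p: "p \<in> \<Lambda>"
  shows "\<wp> (z + p) = \<wp> z"
proof -
  define C where "C = (\<Sum>\<^sub>\<infinity>w\<in>\<Lambda>. 1 / w ^ 2 - 1 / (w + p) ^ 2)"
  have bij: "bij_betw (\<lambda>w. w + p) \<Lambda> \<Lambda>"
    using p by (intro bij_betw_byWitness[where f' = "\<lambda>w. w - p"]) auto
  have *: "\<wp> (z + p) = \<wp> z + C" for z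
  proof -
    have 1: "((\<lambda>w. wp_term (z + p) (w + p)) has_sum \<wp> (z + p)) \<Lambda>"
      using wp_term_summable[of \<Lambda> "z + p"] by (subst has_sum_reindex_bij_betw[OF bij]) (simp add: wp_eq_infsum)
    have 2: "(wp_term z has_sum \<wp> z) \<Lambda>"
      using wp_term_summable[of \<Lambda> z] by (simp add: wp_eq_infsum)
    have "((\<lambda>w. wp_term (z + p) (w + p) - wp_term z w) has_sum (\<wp> (z + p) - \<wp> z)) \<Lambda>"
      using has_sum_add[OF 1 has_sum_uminusI[OF 2]] by simp
    then have "C = \<wp> (z + p) - \<wp> z"
      unfolding C_def by (intro infsumI) (simp add: wp_term_def)
    then show ?thesis by simp
  qed
  have "C = 0"
    using *[of "- p / 2"] wp_minus[of "p / 2"] by simp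
  then show ?thesis using * by simp
qed

lemma wp_meromorphic: "\<wp> meromorphic_on UNIV"
proof -
  have "\<wp> meromorphic_on {z}" for z
  proof (cases "z \<in> \<Lambda>")
    case True
    have "(\<lambda>z. 1 / z ^ 2 + wp_reg z) meromorphic_on {0}"
      using wp_reg_analytic by (intro meromorphic_intros analytic_on_imp_meromorphic_on)
    then have "\<wp> meromorphic_on {0}" by (simp flip: wp_eq_reg)
    then obtain F where "\<wp> has_laurent_expansion F" by (auto simp: meromorphic_on_def)
    moreover have "\<wp> (z + w) = \<wp> w" for w
      using wp_periodic[OF True, of w] by (simp add: add.commute)
    ultimately show ?thesis by (auto simp: meromorphic_on_def)
  qed (use wp_analytic analytic_on_imp_meromorphic_on in blast)
  then show ?thesis using meromorphic_on_meromorphic_at by blast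
qed

text \<open>Removing the integer parts of the coordinates with respect to the periods moves each
  point into a compact parallelogram, so f is bounded and Liouville's theorem applies.\<close>

lemma elliptic_entire_constant:
  assumes hol: "f holomorphic_on UNIV" and per: "\<And>z. f (z + 2 * \<omega>1) = f z" "\<And>z. f (z + 2 * \<omega>3) = f z"
  obtains c where "\<And>z. f z = c"
proof -
  have int_per: "h (z + of_int m * q) = h z" if "\<And>z. h (z + q) = h z" for h :: "complex \<Rightarrow> complex" and m z q
  proof (induction m rule: int_induct[where k = 0])
    case (step1 i)
    then show ?case using that[of "z + of_int i * q"] by (simp add: algebra_simps)
  next
    case (step2 i)
    then show ?case using that[of "z + of_int (i - 1) * q"] by (simp add: algebra_simps)
  qed simp
  let ?K = "(\<lambda>(s, t). 2 * of_real s * \<omega>1 + 2 * of_real t * \<omega>3) ` ({0..1} \<times> {0..1::real})"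
  have K: "compact ?K"
    by (intro compact_continuous_image compact_Times) (auto intro!: continuous_intros simp: case_prod_unfold)
  have "bounded (f ` ?K)"
    by (intro compact_imp_bounded compact_continuous_image[OF _ K])
       (use hol in \<open>auto intro: holomorphic_on_imp_continuous_on continuous_on_subset\<close>)
  moreover have "range f \<subseteq> f ` ?K"
  proof
    fix u assume "u \<in> range f"
    then obtain z where u: "u = f z" by auto
    obtain x y :: real where z: "z = of_real x * \<omega>1 + of_real y * \<omega>3" using real_coordinates by blast
    define z' where "z' = 2 * of_real (frac (x / 2)) * \<omega>1 + 2 * of_real (frac (y / 2)) * \<omega>3"
    have "z = z' + of_int \<lfloor>x / 2\<rfloor> * (2 * \<omega>1) + of_int \<lfloor>y / 2\<rfloor> * (2 * \<omega>3)"
      by (simp add: z z'_def frac_def algebra_simps)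
    then have "f z = f z'" using int_per[of f] per by simp
    moreover have "z' \<in> ?K"
      unfolding z'_def by (rule image_eqI[of _ _ "(frac (x / 2), frac (y / 2))"]) (auto intro: less_imp_le frac_lt_1)
    ultimately show "u \<in> f ` ?K" using u by auto
  qed
  ultimately have "f constant_on UNIV"
    using Liouville_theorem[OF hol] bounded_subset by blast
  then show ?thesis using that by (auto simp: constant_on_def)
qed

text \<open>All singularities are removable, and removing them commutes with translation by a
  period. The conclusion is limited to points of analyticity because the values at removable
  singularities are arbitrary.\<close>

lemma elliptic_nicely_bounded_constant:
  assumes mero: "f meromorphic_on UNIV"
    and per: "\<And>z. f (z + 2 * \<omega>1) = f z" "\<And>z. f (z + 2 * \<omega>3) = f z"
    and nopole: "\<And>z F. (\<lambda>w. f (z + w)) has_laurent_expansion F \<Longrightarrow> fls_subdegree F \<ge> 0"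
  obtains c where "\<And>z. f analytic_on {z} \<Longrightarrow> f z = c"
proof -
  have "remove_sings f analytic_on {z}" for z
  proof -
    obtain F where F: "(\<lambda>w. f (z + w)) has_laurent_expansion F"
      using mero by (auto simp: meromorphic_on_def)
    have "f \<midarrow>z\<rightarrow> fls_nth F 0"
      by (rule has_laurent_expansion_imp_tendsto[OF F nopole[OF F]])
    then show ?thesis
      using mero by (intro remove_sings_analytic_at meromorphic_on_isolated_singularity) (auto intro: meromorphic_on_subset)
  qed
  then have hol: "remove_sings f holomorphic_on UNIV"
    using analytic_imp_holomorphic analytic_on_analytic_at by blast
  have per': "remove_sings f (z + p) = remove_sings f z" if "\<And>z. f (z + p) = f z" for p z
  proof -
    have "(\<lambda>w. f (z + p + w)) = (\<lambda>w. f (z + w))" using that by (metis add.assoc add.commute)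
    then show ?thesis by (metis remove_sings_shift_0)
  qed
  obtain c where "\<And>z. remove_sings f z = c"
    using elliptic_entire_constant[OF hol] per' per by metis
  then show ?thesis using that by (metis remove_sings_at_analytic)
qed

end

section \<open>Local expansions\<close>

text \<open>
  The Duistermaat--Gruenbaum condition: for every \<open>E\<close>, all solutions of \<open>- f'' + v f = E f\<close> are
  meromorphic near \<open>p\<close>.
\<close>

definition trivial_monodromy_at :: "(complex \<Rightarrow> complex) \<Rightarrow> nat \<Rightarrow> complex \<Rightarrow> bool" where
  "trivial_monodromy_at v l p \<longleftrightarrow>
     (\<exists>V. (\<lambda>w. v (p + w)) has_laurent_expansion V \<and> V $$ (-2) = of_nat (l * (l + 1)) \<and>
        (\<forall>i. i < -2 \<longrightarrow> V $$ i = 0) \<and> (\<forall>i. odd i \<longrightarrow> i < 2 * int l \<longrightarrow> V $$ i = 0))"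

lemma trivial_monodromy_atI:
  assumes r: "r analytic_on {0}"
    and eq: "eventually (\<lambda>w. v (p + w) = of_nat (l * (l + 1)) / w ^ 2 + r w) (at 0)"
    and odd: "\<And>n. odd n \<Longrightarrow> n < 2 * l \<Longrightarrow> (deriv ^^ n) r 0 = 0"
  shows "trivial_monodromy_at v l p"
proof -
  define V where "V = fls_const (of_nat (l * (l + 1))) * fls_X_intpow (-2) + fps_to_fls (fps_expansion r 0)"
  have "(\<lambda>w. of_nat (l * (l + 1)) * w powi (-2) + r w) has_laurent_expansion V"
    unfolding V_def by (intro laurent_expansion_intros has_laurent_expansion_fps analytic_at_imp_has_fps_expansion_0 r)
  also have "?this \<longleftrightarrow> (\<lambda>w. v (p + w)) has_laurent_expansion V"
    using eq by (intro has_laurent_expansion_cong refl) (auto elim!: eventually_mono simp: power_int_minus field_simps)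
  finally have 1: "(\<lambda>w. v (p + w)) has_laurent_expansion V" .
  have V: "V $$ i = (if i = -2 then of_nat (l * (l + 1)) else if i < 0 then 0 else (deriv ^^ nat i) r 0 / fact (nat i))" for i
    by (auto simp: V_def fps_expansion_def)
  have "V $$ i = 0" if "odd i" "i < 2 * int l" for i
  proof (cases "i < 0")
    case True
    then show ?thesis using that by (auto simp: V)
  next
    case False
    then have "odd (nat i)" "nat i < 2 * l" using that by (auto simp: even_nat_iff)
    then show ?thesis using odd False by (auto simp: V)
  qed
  then show ?thesis
    unfolding trivial_monodromy_at_def using 1 by (intro exI[of _ V]) (auto simp: V)
qed

text \<open>Substituting -X into the Taylor series changes the sign of its odd coefficients;
  evenness and uniqueness of the expansion then force them to vanish.\<close>

lemma higher_deriv_even_eq_0: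
  fixes r :: "complex \<Rightarrow> complex"
  assumes r: "r analytic_on {0}" and even: "eventually (\<lambda>w. r (- w) = r w) (at 0)" and n: "odd n"
  shows "(deriv ^^ n) r 0 = 0"
proof -
  define R where "R = fps_expansion r 0"
  have R: "r has_fps_expansion R"
    unfolding R_def by (rule analytic_at_imp_has_fps_expansion_0[OF r])
  have "(\<lambda>w::complex. (-1) * w) has_fps_expansion fps_const (-1) * fps_X"
    by (rule has_fps_expansion_cmult_left[OF has_fps_expansion_fps_X])
  then have "(r \<circ> (\<lambda>w. (-1) * w)) has_fps_expansion (R oo (fps_const (-1) * fps_X))"
    by (intro has_fps_expansion_compose R) auto
  moreover have "eventually (\<lambda>w. (r \<circ> (\<lambda>w. (-1) * w)) w = r w) (nhds 0)"
    using even by (auto simp: eventually_nhds_conv_at)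
  ultimately have "r has_fps_expansion (R oo (fps_const (-1) * fps_X))"
    using has_fps_expansion_cong by blast
  then have "R = R oo (fps_const (-1) * fps_X)"
    using R fps_expansion_unique_complex by blast
  then have "R $ n = (R oo (fps_const (-1) * fps_X)) $ n" by simp
  also have "\<dots> = - R $ n" using n by (simp add: fps_compose_linear)
  finally have "R $ n = 0" by simp
  then show ?thesis by (simp add: R_def fps_expansion_def)
qed

lemma analytic_imp_laurent_subdegree_nonneg:
  assumes "r analytic_on {0}" "eventually (\<lambda>w. f (z + w) = r w) (at 0)"
    "(\<lambda>w. f (z + w)) has_laurent_expansion F"
  shows "fls_subdegree F \<ge> 0"
proof -
  have "r has_laurent_expansion F"
    using assms(2,3) by (subst has_laurent_expansion_cong[of _ "\<lambda>w. f (z + w)"]) (auto elim: eventually_mono)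
  moreover have "r has_laurent_expansion fps_to_fls (fps_expansion r 0)"
    by (intro has_laurent_expansion_fps analytic_at_imp_has_fps_expansion_0 assms)
  ultimately have "F = fps_to_fls (fps_expansion r 0)" by (rule has_laurent_expansion_unique)
  then show ?thesis by (simp add: fls_subdegree_fls_to_fps_gt0)
qed

lemma analytic_on_shift:
  assumes "f analytic_on {c + z}"
  shows "(\<lambda>w. f (c + w)) analytic_on {z}" "(\<lambda>w. f (w + c)) analytic_on {z}"
proof -
  have "f \<circ> (\<lambda>w. c + w) analytic_on {z}"
    using assms by (intro analytic_on_compose analytic_intros) auto
  then show "(\<lambda>w. f (c + w)) analytic_on {z}" by (simp add: o_def)
  then show "(\<lambda>w. f (w + c)) analytic_on {z}" by (simp add: add.commute)
qed

section \<open>Half periods and the duplication formula\<close>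

context lattice_basis
begin

abbreviation \<omega> where "\<omega> \<equiv> half_period \<omega>1 \<omega>3"

lemma half_period_simps [simp]:
  "\<omega> 0 = 0" "\<omega> (Suc 0) = \<omega>1" "\<omega> 2 = - \<omega>1 - \<omega>3" "\<omega> 3 = \<omega>3"
  by (simp_all add: half_period_def numeral_2_eq_2 numeral_3_eq_3)

lemma le_3_cases: "(i::nat) \<le> 3 \<Longrightarrow> i = 0 \<or> i = Suc 0 \<or> i = 2 \<or> i = 3"
  by auto

lemma combination_in_lattice_iff:
  "of_int m * \<omega>1 + of_int n * \<omega>3 \<in> \<Lambda> \<longleftrightarrow> even m \<and> even n"
proof
  assume "of_int m * \<omega>1 + of_int n * \<omega>3 \<in> \<Lambda>"
  then obtain m' n' where eq: "of_int m * \<omega>1 + of_int n * \<omega>3 = 2 * of_int m' * \<omega>1 + 2 * of_int n' * \<omega>3"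
    unfolding lattice_iff by blast
  obtain c where c: "c > 0" "\<And>x y::real. c * (\<bar>x\<bar> + \<bar>y\<bar>) \<le> norm (of_real x * \<omega>1 + of_real y * \<omega>3)"
    using norm_lower_bound by blast
  have "of_real (of_int (m - 2 * m')) * \<omega>1 + of_real (of_int (n - 2 * n')) * \<omega>3 = 0"
    using eq by (simp add: algebra_simps)
  then have "c * (\<bar>real_of_int (m - 2 * m')\<bar> + \<bar>real_of_int (n - 2 * n')\<bar>) \<le> 0"
    using c(2)[of "of_int (m - 2 * m')" "of_int (n - 2 * n')"] by simp
  then have "\<bar>real_of_int (m - 2 * m')\<bar> + \<bar>real_of_int (n - 2 * n')\<bar> \<le> 0"
    using c(1) by (simp add: mult_le_0_iff)
  then have "real_of_int (m - 2 * m') = 0" "real_of_int (n - 2 * n') = 0" by linarith+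
  then have "m = 2 * m'" "n = 2 * n'" by linarith+
  then show "even m \<and> even n" by simp
next
  assume "even m \<and> even n"
  then obtain m' n' where "m = 2 * m'" "n = 2 * n'" by (auto elim!: evenE)
  then show "of_int m * \<omega>1 + of_int n * \<omega>3 \<in> \<Lambda>"
    unfolding lattice_iff by (intro exI[of _ m'] exI[of _ n']) simp
qed

lemma half_period_diff_notin: "i \<le> 3 \<Longrightarrow> j \<le> 3 \<Longrightarrow> i \<noteq> j \<Longrightarrow> \<omega> i - \<omega> j \<notin> \<Lambda>"
  using combination_in_lattice_iff[of 1 0] combination_in_lattice_iff[of 0 1] combination_in_lattice_iff[of 1 1]
    combination_in_lattice_iff[of "-1" 0] combination_in_lattice_iff[of 0 "-1"] combination_in_lattice_iff[of "-1" "-1"]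
    combination_in_lattice_iff[of 1 "-1"] combination_in_lattice_iff[of "-1" 1]
    combination_in_lattice_iff[of 2 1] combination_in_lattice_iff[of 1 2]
    combination_in_lattice_iff[of "-2" "-1"] combination_in_lattice_iff[of "-1" "-2"]
  by (drule_tac le_3_cases, drule_tac le_3_cases) (elim disjE; simp add: algebra_simps)

lemma double_half_period_in: "i \<le> 3 \<Longrightarrow> 2 * \<omega> i \<in> \<Lambda>"
  using combination_in_lattice_iff[of 2 0] combination_in_lattice_iff[of 0 2] combination_in_lattice_iff[of "-2" "-2"]
  by (drule_tac le_3_cases) (elim disjE; simp add: algebra_simps)

text \<open>The points of order two modulo \<Lambda>: the four parity patterns of (m, n) correspond
  to the four half periods.\<close>

lemma double_in_lattice:
  assumes "2 * z \<in> \<Lambda>"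
  obtains i where "i \<le> 3" "z + \<omega> i \<in> \<Lambda>"
proof -
  obtain m n where "2 * z = 2 * of_int m * \<omega>1 + 2 * of_int n * \<omega>3"
    using assms unfolding lattice_iff by blast
  then have "2 * z = 2 * (of_int m * \<omega>1 + of_int n * \<omega>3)" by (simp add: algebra_simps)
  then have z: "z = of_int m * \<omega>1 + of_int n * \<omega>3" by (simp only: mult_cancel_left) simp
  have 1: "z + \<omega> 1 = of_int (m + 1) * \<omega>1 + of_int n * \<omega>3" "z + \<omega> 2 = of_int (m - 1) * \<omega>1 + of_int (n - 1) * \<omega>3"
     "z + \<omega> 3 = of_int m * \<omega>1 + of_int (n + 1) * \<omega>3" "z + \<omega> 0 = of_int m * \<omega>1 + of_int n * \<omega>3"
    by (simp_all add: z algebra_simps)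
  show ?thesis
    using that[of 0] that[of 1] that[of 2] that[of 3]
    unfolding 1 combination_in_lattice_iff by (cases "even m"; cases "even n") auto
qed

lemma wp_deriv: "z \<notin> \<Lambda> \<Longrightarrow> (\<wp> has_field_derivative deriv \<wp> z) (at z)"
  by (intro analytic_derivI wp_analytic)

lemma wp_shift_meromorphic: "(\<lambda>x. \<wp> (x + c)) meromorphic_on UNIV"
  unfolding meromorphic_on_def
proof
  fix z
  obtain F where "(\<lambda>w. \<wp> (z + c + w)) has_laurent_expansion F"
    using wp_meromorphic by (auto simp: meromorphic_on_def)
  then show "\<exists>F. (\<lambda>w. \<wp> (z + w + c)) has_laurent_expansion F"
    by (auto simp: add_ac)
qed

text \<open>The elliptic function 4 \<wp>(2z) - \<Sum> \<wp>(z + \<omega>_i) can have poles only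
  where 2z is a period. There exactly one summand is singular, and its 1/w^2 cancels against
  4/(2w)^2. So the function is constant, and its derivative is the claim.\<close>

lemma wp_duplication_deriv:
  assumes "2 * z \<notin> \<Lambda>"
  shows "8 * deriv \<wp> (2 * z) = (\<Sum>i=0..3. deriv \<wp> (z + \<omega> i))"
proof -
  define G where "G = (\<lambda>z. 4 * \<wp> (2 * z) - (\<Sum>i=0..3. \<wp> (z + \<omega> i)))"
  have ana2: "(\<lambda>z. f (2 * z)) analytic_on {z}" if "f analytic_on {2 * z}" for f and z :: complex
  proof -
    have "f \<circ> (\<lambda>z. 2 * z) analytic_on {z}"
      using that by (intro analytic_on_compose analytic_intros) auto
    then show ?thesis by (simp add: o_def)
  qed
  have half_notin: "z + \<omega> i \<notin> \<Lambda>" if "2 * z \<notin> \<Lambda>" "i \<le> 3" for z i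
  proof
    assume "z + \<omega> i \<in> \<Lambda>"
    then have "(z + \<omega> i) + (z + \<omega> i) - 2 * \<omega> i \<in> \<Lambda>"
      using double_half_period_in[OF that(2)] by blast
    then show False using that by (simp add: algebra_simps)
  qed
  have Gana: "G analytic_on {z}" if "2 * z \<notin> \<Lambda>" for z
    unfolding G_def using that half_notin[OF that]
    by (intro analytic_intros ana2 wp_analytic analytic_on_shift) (auto simp: add.commute)
  \<comment> \<open>Equality with the analytic r holds at w = 0 as well: both cancelled terms 4 /
    (2w)^2 and 1 / w^2 take the value 0 there by convention.\<close>
  have loc: "\<exists>r. r analytic_on {0} \<and> (\<forall>w. G (z + w) = r w)" for z
  proof (cases "2 * z \<in> \<Lambda>")
    case False
    then show ?thesis
      using analytic_on_shift(1)[of G z 0] Gana[OF False] by auto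
  next
    case True
    then obtain i where i: "i \<le> 3" "z + \<omega> i \<in> \<Lambda>" using double_in_lattice by blast
    define r where "r = (\<lambda>w. 4 * wp_reg (2 * w) - wp_reg w - (\<Sum>j\<in>{0..3} - {i}. \<wp> (w + (z + \<omega> j))))"
    have "z + \<omega> j \<notin> \<Lambda>" if "j \<in> {0..3} - {i}" for j
    proof
      assume "z + \<omega> j \<in> \<Lambda>"
      then have "(z + \<omega> j) - (z + \<omega> i) \<in> \<Lambda>" using i by blast
      then show False using half_period_diff_notin[of j i] that i by auto
    qed
    then have "r analytic_on {0}"
      unfolding r_def
      by (intro analytic_intros ana2 analytic_on_shift wp_analytic) (auto simp: wp_reg_analytic)
    moreover have "G (z + w) = r w" for w
    proof -
      have "\<wp> (2 * (z + w)) = \<wp> (2 * w)" using wp_periodic[OF True, of "2 * w"] by (simp add: algebra_simps)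
      moreover have "(\<Sum>j=0..3. \<wp> (z + w + \<omega> j)) = \<wp> (z + w + \<omega> i) + (\<Sum>j\<in>{0..3} - {i}. \<wp> (z + w + \<omega> j))"
        using i by (intro sum.remove) auto
      moreover have "\<wp> (z + w + \<omega> i) = \<wp> w" using wp_periodic[OF i(2), of w] by (simp add: algebra_simps)
      ultimately have "G (z + w) = 4 * \<wp> (2 * w) - \<wp> w - (\<Sum>j\<in>{0..3} - {i}. \<wp> (z + w + \<omega> j))"
        by (simp add: G_def)
      also have "\<dots> = r w"
        by (simp add: r_def wp_eq_reg[of "2 * w"] wp_eq_reg[of w] power_mult_distrib add_ac)
      finally show ?thesis .
    qed
    ultimately show ?thesis by blast
  qed
  have "G meromorphic_on UNIV"
    unfolding meromorphic_on_def
  proof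
    fix z
    obtain r where "r analytic_on {0}" "\<And>w. G (z + w) = r w" using loc by blast
    then have "(\<lambda>w. G (z + w)) has_laurent_expansion fps_to_fls (fps_expansion r 0)"
      by (auto intro!: has_laurent_expansion_fps analytic_at_imp_has_fps_expansion_0)
    then show "\<exists>F. (\<lambda>w. G (z + w)) has_laurent_expansion F" by blast
  qed
  moreover have "G (z + p) = G z" if "p \<in> \<Lambda>" for z p
  proof -
    have "\<wp> (2 * (z + p)) = \<wp> (2 * z)"
      using wp_periodic[OF lattice_add[OF that that], of "2 * z"] by (simp add: algebra_simps)
    moreover have "\<wp> (z + p + \<omega> i) = \<wp> (z + \<omega> i)" for i
      using wp_periodic[OF that, of "z + \<omega> i"] by (simp add: algebra_simps)
    ultimately show ?thesis by (simp add: G_def)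
  qed
  moreover have "fls_subdegree F \<ge> 0" if "(\<lambda>w. G (z + w)) has_laurent_expansion F" for z F
    using loc[of z] analytic_imp_laurent_subdegree_nonneg[OF _ _ that] by auto
  ultimately obtain c where c: "\<And>z. G analytic_on {z} \<Longrightarrow> G z = c"
    using elliptic_nicely_bounded_constant lattice_periods by metis
  obtain A where A: "open A" "z \<in> A" "G holomorphic_on A"
    using Gana[OF assms] by (auto simp: analytic_at)
  then have "G analytic_on {y}" if "y \<in> A" for y
    using that by (auto simp: analytic_at)
  then have "eventually (\<lambda>y. G y = c) (nhds z)"
    using A c by (auto simp: eventually_nhds)
  then have "deriv G z = 0" using deriv_cong_ev[of G "\<lambda>_. c" z z] by simp
  moreover have "(G has_field_derivative 4 * (deriv \<wp> (2 * z) * 2) - (\<Sum>i=0..3. deriv \<wp> (z + \<omega> i))) (at z)"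
    unfolding G_def
  proof (intro DERIV_diff DERIV_cmult DERIV_sum)
    show "((\<lambda>z. \<wp> (2 * z)) has_field_derivative deriv \<wp> (2 * z) * 2) (at z)"
    proof (rule DERIV_chain2[where f = "\<wp>" and g = "\<lambda>z. 2 * z"])
      show "(\<wp> has_field_derivative deriv \<wp> (2 * z)) (at (2 * z))" by (rule wp_deriv[OF assms])
      show "((\<lambda>z. 2 * z) has_field_derivative 2) (at z)" by (auto intro!: derivative_eq_intros)
    qed
    show "((\<lambda>z. \<wp> (z + \<omega> i)) has_field_derivative deriv \<wp> (z + \<omega> i)) (at z)" if "i \<in> {0..3}" for i
      using wp_deriv[OF half_notin[OF assms]] that by (simp add: DERIV_shift)
  qed
  ultimately have "4 * (deriv \<wp> (2 * z) * 2) - (\<Sum>i=0..3. deriv \<wp> (z + \<omega> i)) = 0"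
    using DERIV_imp_deriv by force
  then show ?thesis by simp
qed

end

text \<open>Gaussian elimination on a sequence of vectors indexed by a finite set. The pivot for
  coordinate i is some \<phi>_m preceding all vectors that are kept, so correcting by it never
  touches the last coefficient, which stays 1. This normalisation later yields a_0 = 1.\<close>

lemma monic_linear_relation:
  fixes \<phi> :: "nat \<Rightarrow> 'i \<Rightarrow> complex"
  assumes "finite I"
  shows "\<exists>K c. c K = 1 \<and> (\<forall>i\<in>I. (\<Sum>k\<le>K. c k * \<phi> k i) = 0)"
  using assms
proof (induction I arbitrary: \<phi> rule: finite_induct)
  case empty
  show ?case by (rule exI[of _ 0], rule exI[of _ "\<lambda>_. 1"]) simp
next
  case (insert i I)
  show ?case
  proof (cases "\<forall>k. \<phi> k i = 0")
    case True
    then show ?thesis using insert.IH[of \<phi>] by auto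
  next
    case False
    then obtain m where m: "\<phi> m i \<noteq> 0" by blast
    define q where "q k = \<phi> (Suc m + k) i / \<phi> m i" for k
    obtain K c where c: "c K = 1" "\<And>j. j \<in> I \<Longrightarrow> (\<Sum>k\<le>K. c k * (\<phi> (Suc m + k) j - q k * \<phi> m j)) = 0"
      using insert.IH[of "\<lambda>k j. \<phi> (Suc m + k) j - q k * \<phi> m j"] by blast
    \<comment> \<open>The relation for the reduced vectors is shifted by m + 1, and the multiples of
      \<phi>_m that had been subtracted are collected at index m.\<close>
    define c' where "c' k = (if k < m then 0 else if k = m then - (\<Sum>k\<le>K. c k * q k) else c (k - Suc m))" for k
    have "(\<Sum>k\<le>Suc m + K. c' k * \<phi> k j) = (\<Sum>k\<le>K. c k * (\<phi> (Suc m + k) j - q k * \<phi> m j))" for j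
    proof -
      have "{..Suc m + K} = {..<m} \<union> ({m} \<union> {Suc m..Suc m + K})" by auto
      then have "(\<Sum>k\<le>Suc m + K. c' k * \<phi> k j) = (\<Sum>k<m. c' k * \<phi> k j) + (c' m * \<phi> m j + (\<Sum>k=Suc m..Suc m + K. c' k * \<phi> k j))"
        by (simp only:) (subst sum.union_disjoint; force)+
      also have "(\<Sum>k<m. c' k * \<phi> k j) = 0" by (simp add: c'_def)
      also have "(\<Sum>k=Suc m..Suc m + K. c' k * \<phi> k j) = (\<Sum>k\<le>K. c k * \<phi> (Suc m + k) j)"
        by (rule sum.reindex_bij_witness[of _ "\<lambda>k. Suc m + k" "\<lambda>k. k - Suc m"]) (auto simp: c'_def)
      finally have E: "(\<Sum>k\<le>Suc m + K. c' k * \<phi> k j) =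
        0 + (c' m * \<phi> m j + (\<Sum>k\<le>K. c k * \<phi> (Suc m + k) j))" .
      have "c' m = - (\<Sum>k\<le>K. c k * q k)" by (simp add: c'_def)
      then show ?thesis
        unfolding E by (simp add: sum_distrib_right sum_subtractf right_diff_distrib mult.assoc)
    qed
    moreover have "(\<Sum>k\<le>K. c k * (\<phi> (Suc m + k) i - q k * \<phi> m i)) = 0"
      using m by (simp add: q_def)
    moreover have "c' (Suc m + K) = 1" using c by (simp add: c'_def)
    ultimately show ?thesis
      using c(2) by (intro exI[of _ "Suc m + K"] exI[of _ c']) auto
  qed
qed

section \<open>Laurent coefficients of the Gelfand--Dikii polynomials, and passage to finite-gap
  operators\<close>

lemma kdv_op_sum:
  assumes "open S" "x \<in> S" "\<And>i. i \<in> J \<Longrightarrow> h i holomorphic_on S"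
  shows "kdv_op v (\<lambda>y. \<Sum>i\<in>J. c i * h i y) x = (\<Sum>i\<in>J. c i * kdv_op v (h i) x)"
proof -
  have d: "deriv (\<lambda>y. \<Sum>i\<in>J. c i * u i y) y = (\<Sum>i\<in>J. c i * deriv (u i) y)"
    if "\<And>i. i \<in> J \<Longrightarrow> u i holomorphic_on S" "y \<in> S" for u y
    using that assms by (intro DERIV_imp_deriv DERIV_sum DERIV_cmult holomorphic_derivI[of _ S]) auto
  have d': "deriv f x = (\<Sum>i\<in>J. c i * deriv (u i) x)"
    if "\<And>y. y \<in> S \<Longrightarrow> f y = (\<Sum>i\<in>J. c i * u i y)" "\<And>i. i \<in> J \<Longrightarrow> u i holomorphic_on S" "x \<in> S" for f u x
  proof -
    have "deriv f x = deriv (\<lambda>y. \<Sum>i\<in>J. c i * u i y) x"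
      using that(1,3) assms(1) by (intro deriv_cong_ev) (auto simp: eventually_nhds)
    then show ?thesis using d that by simp
  qed
  have 1: "deriv (\<lambda>y. \<Sum>i\<in>J. c i * h i y) y = (\<Sum>i\<in>J. c i * deriv (h i) y)" if "y \<in> S" for y
    by (rule d') (use assms that in auto)
  have 2: "deriv (deriv (\<lambda>y. \<Sum>i\<in>J. c i * h i y)) y = (\<Sum>i\<in>J. c i * deriv (deriv (h i)) y)" if "y \<in> S" for y
    by (rule d') (use 1 assms that in \<open>auto intro!: holomorphic_intros\<close>)
  have 3: "deriv (deriv (deriv (\<lambda>y. \<Sum>i\<in>J. c i * h i y))) x = (\<Sum>i\<in>J. c i * deriv (deriv (deriv (h i))) x)"
    by (rule d') (use 2 assms in \<open>auto intro!: holomorphic_intros\<close>)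
  show ?thesis
    unfolding kdv_op_def 1[OF assms(2)] 3
    by (simp add: sum_distrib_left sum.distrib sum_subtractf algebra_simps)
qed

lemma gelfand_dikii_laurent:
  assumes v: "v meromorphic_on UNIV" "open S" "v holomorphic_on S"
    and ev: "eventually (\<lambda>y. y \<in> S) (at p)"
    and tm: "trivial_monodromy_at v l p"
    and t: "t < - 2 * int l \<or> odd t \<and> t < 0"
  shows "laurent_expansion (gelfand_dikii v k) p $$ t = 0"
proof -
  obtain V where V: "(\<lambda>w. v (p + w)) has_laurent_expansion V" "V $$ (-2) = of_nat (l * (l + 1))"
    "\<And>i. i < -2 \<Longrightarrow> V $$ i = 0" "\<And>i. odd i \<Longrightarrow> i < 2 * int l \<Longrightarrow> V $$ i = 0"
    using tm unfolding trivial_monodromy_at_def by blast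
  define F where "F k = laurent_expansion (gelfand_dikii v k) p" for k
  have F: "(\<lambda>w. gelfand_dikii v k (p + w)) has_laurent_expansion F k" for k
    using gelfand_dikii_meromorphic[OF v(1), of k] by (simp add: meromorphic_on_def' F_def)
  have D: "(\<lambda>w. deriv f (p + w)) has_laurent_expansion fls_deriv G" if "(\<lambda>w. f (p + w)) has_laurent_expansion G" for f G
    using has_laurent_expansion_deriv[OF that] deriv_add_shift[of f _ p] by (simp add: add.commute)
  \<comment> \<open>The recursion is available only on \<open>S\<close>; a punctured neighbourhood
    of p inside \<open>S\<close> is enough to identify Laurent series.\<close>
  have ev': "eventually (\<lambda>w. p + w \<in> S) (at 0)"
    using ev by (simp add: at_to_0'[of p] eventually_filtermap add.commute)
  have step: "4 * fls_deriv (F (Suc k)) = 4 * V * fls_deriv (F k) + 2 * fls_deriv V * F k - fls_deriv (fls_deriv (fls_deriv (F k)))" for k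
  proof (rule has_laurent_expansion_unique)
    show "(\<lambda>w. 4 * deriv (gelfand_dikii v (Suc k)) (p + w)) has_laurent_expansion 4 * fls_deriv (F (Suc k))"
      by (intro laurent_expansion_intros D F)
    have "(\<lambda>w. kdv_op v (gelfand_dikii v k) (p + w)) has_laurent_expansion 4 * V * fls_deriv (F k) + 2 * fls_deriv V * F k - fls_deriv (fls_deriv (fls_deriv (F k)))"
      unfolding kdv_op_def by (intro laurent_expansion_intros D F V(1))
    then show "(\<lambda>w. 4 * deriv (gelfand_dikii v (Suc k)) (p + w)) has_laurent_expansion 4 * V * fls_deriv (F k) + 2 * fls_deriv V * F k - fls_deriv (fls_deriv (fls_deriv (F k)))"
      by (rule has_laurent_expansion_cong[THEN iffD1, rotated -1])
         (use ev' gelfand_dikii_recursion[OF v(2,3)] in \<open>auto elim!: eventually_mono\<close>)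
  qed
  have "F k $$ t = 0" if "t < - 2 * int l \<or> odd t \<and> t < 0" for t
    using that
  proof (induction k arbitrary: t)
    case 0
    have "(\<lambda>w. 1) has_laurent_expansion F 0" using F[of 0] by simp
    then have "F 0 = 1" using has_laurent_expansion_unique has_laurent_expansion_1 by blast
    then show ?case using 0 by auto
  next
    case (Suc k)
    show ?case
      by (rule gelfand_dikii_pole_step[OF V(2,3,4) _ _ step Suc.prems]) (use Suc.IH in auto)
  qed
  then show ?thesis using t by (simp add: F_def)
qed

lemma schroedinger_op_cong:
  assumes "open U" "x \<in> U" "\<And>y. y \<in> U \<Longrightarrow> f y = g y"
  shows "schroedinger_op v f x = schroedinger_op v g x"
proof -
  have "deriv f y = deriv g y" if "y \<in> U" for y
    using assms that by (intro deriv_cong_ev) (auto simp: eventually_nhds)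
  then have "deriv (deriv f) x = deriv (deriv g) x"
    using assms by (intro deriv_cong_ev) (auto simp: eventually_nhds)
  then show ?thesis using assms by (simp add: schroedinger_op_def numeral_2_eq_2)
qed

text \<open>Besides making the operator monic, this moves the commutation from \<open>S\<close> to
  the set of all points where the potential and the coefficients are analytic, which may be
  larger.\<close>

lemma commute_on_leading_imp_finite_gap_potential:
  assumes v: "v meromorphic_on UNIV" "v holomorphic_on S"
    and S: "open S" "\<And>x. eventually (\<lambda>y. y \<in> S) (at x)"
    and comm: "commute_on S A (schroedinger_op v)"
    and lead: "low_order_op S (2 * g) (\<lambda>f x. A f x - (-1) ^ g * (deriv ^^ (2 * g + 1)) f x)"
  shows "finite_gap_potential v"
proof -
  obtain c where c: "\<And>i. c i meromorphic_on UNIV \<and> c i holomorphic_on S"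
    "\<And>U f x. open U \<and> U \<subseteq> S \<and> f holomorphic_on U \<and> x \<in> U \<Longrightarrow>
       A f x - (-1) ^ g * (deriv ^^ (2 * g + 1)) f x = (\<Sum>i<2*g. c i x * (deriv ^^ i) f x)"
    by (rule low_order_opE[OF lead]) (rule that)
  \<comment> \<open>The sign makes the leading coefficient 1; the index is reversed because
    \<open>finite_gap_potential\<close> counts coefficients downwards from order 2g - 1.\<close>
  define b where "b j x = (-1) ^ g * c (2 * g - 1 - j) x" for j x
  define B where "B = (\<lambda>f x. (deriv ^^ (2*g+1)) f x + (\<Sum>j<2*g. b j x * (deriv ^^ (2*g-1-j)) f x))"
  define T where "T = {x. v analytic_on {x} \<and> (\<forall>j<2*g. b j analytic_on {x})}"
  have AB: "A f x = (-1) ^ g * B f x" if "open U" "U \<subseteq> S" "f holomorphic_on U" "x \<in> U" for U f x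
  proof -
    have "(\<Sum>j<2*g. b j x * (deriv ^^ (2*g-1-j)) f x) = (-1) ^ g * (\<Sum>i<2*g. c i x * (deriv ^^ i) f x)"
      unfolding sum_distrib_left
      by (rule sum.reindex_bij_witness[of _ "\<lambda>j. 2*g-1-j" "\<lambda>j. 2*g-1-j"]) (auto simp: b_def)
    then have "(-1) ^ g * B f x = (-1) ^ g * (deriv ^^ (2*g+1)) f x + ((-1) ^ g * (-1) ^ g) * (\<Sum>i<2*g. c i x * (deriv ^^ i) f x)"
      unfolding B_def by (simp only: distrib_left mult.assoc)
    also have "(-1) ^ g * (-1) ^ g = (1 :: complex)"
      by (rule minus_one_mult_self)
    finally show ?thesis
      using c(2)[of U f x] that by (simp add: diff_eq_eq)
  qed
  have "commute_on T B (schroedinger_op v)"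
    unfolding commute_on_def
  proof (intro allI impI ballI, elim conjE)
    fix U f x assume U: "open U" "U \<subseteq> T" and f: "f holomorphic_on U" and x: "x \<in> U"
    define H where "H = schroedinger_op v"
    have bU: "b j holomorphic_on U" if "j < 2 * g" for j
    proof -
      have "b j analytic_on {y}" if "y \<in> U" for y using U that \<open>j < 2 * g\<close> by (auto simp: T_def)
      then show ?thesis using analytic_imp_holomorphic analytic_on_analytic_at by blast
    qed
    have vU: "v holomorphic_on U"
    proof -
      have "v analytic_on {y}" if "y \<in> U" for y using U that by (auto simp: T_def)
      then show ?thesis using analytic_imp_holomorphic analytic_on_analytic_at by blast
    qed
    have Bhol: "B h holomorphic_on U" if "h holomorphic_on U" for h
      unfolding B_def using that U bU by (intro holomorphic_intros holomorphic_higher_deriv) auto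
    have Hhol: "H h holomorphic_on U" if "h holomorphic_on U" for h
      unfolding H_def by (rule schroedinger_op_holomorphic[OF U(1) vU that])
    define W where "W = U \<inter> S"
    have W: "open W" "W \<subseteq> S" using U S by (auto simp: W_def)
    have eq: "B (H f) y = H (B f) y" if y: "y \<in> W" for y
    proof -
      have fW: "f holomorphic_on W" "H f holomorphic_on W" "B f holomorphic_on W"
        using f Hhol[OF f] Bhol[OF f] by (auto simp: W_def intro: holomorphic_on_subset)
      have "(-1) ^ g * B (H f) y = A (H f) y" using AB[OF W fW(2) y] by simp
      also have "\<dots> = H (A f) y"
        unfolding H_def using comm[unfolded commute_on_def, rule_format, of W f y] W fW(1) y by auto
      also have "\<dots> = H (\<lambda>y. \<Sum>j\<in>{0::nat}. (-1) ^ g * B f y) y"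
        unfolding H_def using AB[OF W fW(1)] by (intro schroedinger_op_cong[OF W(1) y]) simp
      also have "\<dots> = (-1) ^ g * H (B f) y"
      proof -
        have d: "deriv (\<lambda>y. (-1) ^ g * u y) y = (-1) ^ g * deriv u y" if "u holomorphic_on W" "y \<in> W" for u y
          using that W by (intro DERIV_imp_deriv DERIV_cmult holomorphic_derivI[of _ W])
        have "deriv (deriv (\<lambda>y. (-1) ^ g * B f y)) y = deriv (\<lambda>y. (-1) ^ g * deriv (B f) y) y"
          using d[OF fW(3)] W(1) y by (intro deriv_cong_ev) (auto simp: eventually_nhds)
        also have "\<dots> = (-1) ^ g * deriv (deriv (B f)) y"
          using fW(3) W(1) y by (intro d holomorphic_intros)
        finally show ?thesis by (simp add: H_def schroedinger_op_def numeral_2_eq_2 algebra_simps)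
      qed
      finally show ?thesis by simp
    qed
    \<comment> \<open>Every punctured neighbourhood is eventually inside \<open>S\<close>, so the
      identity known on \<open>W\<close> extends to x by continuity of both sides.\<close>
    have "eventually (\<lambda>y. y \<in> W) (at x)"
      using eventually_conj[OF eventually_at_in_open'[OF U(1) x] S(2)[of x]] by (simp add: W_def)
    then have ev: "eventually (\<lambda>y. B (H f) y = H (B f) y) (at x)"
      by (rule eventually_mono) (rule eq)
    have "continuous_on U (B (H f))" "continuous_on U (H (B f))"
      using f by (auto intro!: holomorphic_on_imp_continuous_on Bhol Hhol)
    then have "(B (H f) \<longlongrightarrow> B (H f) x) (at x)" "(H (B f) \<longlongrightarrow> H (B f) x) (at x)"
      using U(1) x by (auto simp: continuous_on_eq_continuous_at isCont_def)
    then have "B (H f) x = H (B f) x"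
      by (intro tendsto_unique[OF at_neq_bot, of "B (H f)" _ x]) (simp_all add: tendsto_cong[OF ev])
    then show "B (schroedinger_op v f) x = schroedinger_op v (B f) x" by (simp add: H_def)
  qed
  moreover have "b j meromorphic_on UNIV" for j
    unfolding b_def using c(1) by (intro meromorphic_intros) auto
  ultimately show ?thesis
    unfolding finite_gap_potential_def B_def T_def by (intro conjI v(1) exI[of _ g] exI[of _ b]) auto
qed

context lattice_basis
begin

text \<open>\<open>P\<close> represents the singular points modulo the lattice, so finitely many
  principal parts decide whether a combination of the f_k is free of poles. Such a combination is
  constant by Liouville's theorem, and its zero derivative is the stationarity condition.\<close>

theorem trivial_monodromy_imp_finite_gap_potential:
  assumes v: "v meromorphic_on UNIV" "v holomorphic_on S"
    and S: "open S" "\<And>x. eventually (\<lambda>y. y \<in> S) (at x)"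
    and per: "\<And>p x. p \<in> \<Lambda> \<Longrightarrow> v (x + p) = v x"
    and P: "finite P" "\<And>x. x \<notin> S \<Longrightarrow> \<exists>p\<in>P. x - p \<in> \<Lambda>"
    and tm: "\<And>p. p \<in> P \<Longrightarrow> \<exists>n. trivial_monodromy_at v n p"
  shows "finite_gap_potential v"
proof -
  obtain n where n: "\<And>p. p \<in> P \<Longrightarrow> trivial_monodromy_at v (n p) p"
    using tm by metis
  define f where "f = gelfand_dikii v"
  have f_hol: "f k holomorphic_on S" for k
    unfolding f_def by (rule gelfand_dikii_holomorphic[OF S(1) v(2)])
  have f_mero: "f k meromorphic_on UNIV" for k
    unfolding f_def by (rule gelfand_dikii_meromorphic[OF v(1)])
  have f_per: "f k (x + p) = f k x" if "p \<in> \<Lambda>" for k x p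
    unfolding f_def by (rule gelfand_dikii_periodic) (rule per[OF that])
  have f_rec: "4 * deriv (f (Suc k)) x = kdv_op v (f k) x" if "x \<in> S" for k x
    unfolding f_def by (rule gelfand_dikii_recursion[OF S(1) v(2) that])
  \<comment> \<open>These are all polar orders that need a linear condition; lower orders vanish
    automatically. The relation starts at f_1, so that its last member f_(K+1) matches the recursion
    step leaving a_K.\<close>
  define I where "I = (SIGMA p:P. {- 2 * int (n p)..-1})"
  have "finite I" unfolding I_def using P(1) by blast
  from monic_linear_relation[OF this, of "\<lambda>k i. laurent_expansion (f (Suc k)) (fst i) $$ snd i"]
  obtain K c where "c K = 1 \<and> (\<forall>i\<in>I. (\<Sum>k\<le>K. c k * laurent_expansion (f (Suc k)) (fst i) $$ snd i) = 0)"
    by (elim exE) (rule that)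
  then have c: "c K = 1"
    "\<And>i. i \<in> I \<Longrightarrow> (\<Sum>k\<le>K. c k * laurent_expansion (f (Suc k)) (fst i) $$ snd i) = 0"
    by blast+
  define h where "h = (\<lambda>x. \<Sum>k\<le>K. c k * f (Suc k) x)"
  have h_hol: "h holomorphic_on S"
    unfolding h_def using f_hol by (intro holomorphic_intros)
  have h_ana: "h analytic_on {x}" if "x \<in> S" for x
    using h_hol S(1) that analytic_at by blast
  have h_per: "h (x + p) = h x" if "p \<in> \<Lambda>" for x p
    unfolding h_def using f_per[OF that] by simp
  have h_mero: "h meromorphic_on UNIV"
    unfolding h_def using f_mero by (intro meromorphic_intros)
  have nopole: "fls_subdegree F \<ge> 0" if F: "(\<lambda>w. h (z + w)) has_laurent_expansion F" for z F
  proof (cases "z \<in> S")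
    case True
    then show ?thesis
      using analytic_imp_laurent_subdegree_nonneg[OF _ _ F, of "\<lambda>w. h (z + w)"] analytic_on_shift(1)[of h z 0] h_ana by simp
  next
    case False
    then obtain p where p: "p \<in> P" "z - p \<in> \<Lambda>" using P(2) by blast
    have "h (z + w) = h (p + w)" for w
      using h_per[OF p(2), of "p + w"] by (simp add: algebra_simps)
    then have "(\<lambda>w. h (p + w)) has_laurent_expansion F" using F by simp
    moreover have "(\<lambda>w. h (p + w)) has_laurent_expansion (\<Sum>k\<le>K. fls_const (c k) * laurent_expansion (f (Suc k)) p)"
      unfolding h_def using f_mero by (intro laurent_expansion_intros) (auto simp: meromorphic_on_def')
    ultimately have F': "F = (\<Sum>k\<le>K. fls_const (c k) * laurent_expansion (f (Suc k)) p)"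
      by (rule has_laurent_expansion_unique)
    show ?thesis
    proof (rule fls_subdegree_ge0I)
      fix s :: int assume "s < 0"
      have Fs: "F $$ s = (\<Sum>k\<le>K. c k * laurent_expansion (f (Suc k)) p $$ s)"
        by (simp add: F' fls_nth_sum)
      show "F $$ s = 0"
      proof (cases "s < - 2 * int (n p)")
        case True
        then have "laurent_expansion (f (Suc k)) p $$ s = 0" for k
          unfolding f_def by (intro gelfand_dikii_laurent[OF v(1) S(1) v(2) S(2) n[OF p(1)]]) auto
        then show ?thesis by (simp add: Fs)
      next
        case False
        then have "(p, s) \<in> I" using p \<open>s < 0\<close> by (auto simp: I_def)
        then show ?thesis using c(2)[of "(p, s)"] by (simp add: Fs)
      qed
    qed
  qed
  obtain C where C: "\<And>z. h analytic_on {z} \<Longrightarrow> h z = C"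
    by (rule elliptic_nicely_bounded_constant[OF h_mero h_per[OF lattice_periods(1)]
          h_per[OF lattice_periods(2)] nopole]) (assumption, rule that)
  have h': "deriv h x = 0" if "x \<in> S" for x
  proof -
    have "deriv h x = deriv (\<lambda>_. C) x"
      using C h_ana S(1) that by (intro deriv_cong_ev) (auto simp: eventually_nhds)
    then show ?thesis by simp
  qed
  \<comment> \<open>Reversing the coefficients puts the monic one into \<open>a 0\<close> and turns
    \<open>kdv_op v (a K)\<close> into 4 h', which is 0 because h is constant on
    \<open>S\<close>.\<close>
  define \<gamma> where "\<gamma> i = c (K - i)" for i
  define a where "a j = (\<lambda>x. \<Sum>i\<le>j. \<gamma> i * f (j - i) x)" for j
  have a_hol: "a j holomorphic_on S" for j
    unfolding a_def using f_hol by (intro holomorphic_intros)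
  have a_mero: "a j meromorphic_on UNIV" for j
    unfolding a_def using f_mero by (intro meromorphic_intros)
  have a0: "a 0 = (\<lambda>x. 1)"
    by (simp add: a_def \<gamma>_def c(1) f_def)
  have D: "(f k has_field_derivative deriv (f k) x) (at x)" if "x \<in> S" for k x
    using f_hol S(1) that by (intro holomorphic_derivI)
  have kdv: "kdv_op v (a j) x = (\<Sum>i\<le>j. \<gamma> i * (4 * deriv (f (Suc j - i)) x))" if "x \<in> S" for j x
  proof -
    have "kdv_op v (a j) x = (\<Sum>i\<le>j. \<gamma> i * kdv_op v (f (j - i)) x)"
      unfolding a_def using S(1) that f_hol by (intro kdv_op_sum)
    also have "\<dots> = (\<Sum>i\<le>j. \<gamma> i * (4 * deriv (f (Suc j - i)) x))"
      using f_rec[OF that] by (intro sum.cong) (auto simp: Suc_diff_le)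
    finally show ?thesis .
  qed
  have rec: "4 * deriv (a (Suc j)) x = kdv_op v (a j) x" if "x \<in> S" for j x
  proof -
    have "deriv (a (Suc j)) x = (\<Sum>i\<le>Suc j. \<gamma> i * deriv (f (Suc j - i)) x)"
      unfolding a_def using D[OF that] by (intro DERIV_imp_deriv DERIV_sum DERIV_cmult)
    moreover have "deriv (f 0) x = 0" by (simp add: f_def)
    ultimately show ?thesis by (simp add: kdv[OF that] sum_distrib_left algebra_simps)
  qed
  have stat: "kdv_op v (a K) x = 0" if "x \<in> S" for x
  proof -
    have "deriv h x = (\<Sum>k\<le>K. c k * deriv (f (Suc k)) x)"
      unfolding h_def using D[OF that] by (intro DERIV_imp_deriv DERIV_sum DERIV_cmult)
    also have "\<dots> = (\<Sum>i\<le>K. \<gamma> i * deriv (f (Suc K - i)) x)"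
      by (rule sum.reindex_bij_witness[of _ "\<lambda>i. K - i" "\<lambda>i. K - i"]) (auto simp: \<gamma>_def Suc_diff_le)
    finally have "kdv_op v (a K) x = 4 * deriv h x"
      by (simp add: kdv[OF that] sum_distrib_left algebra_simps)
    then show ?thesis using h'[OF that] by simp
  qed
  have "commute_on S (A_op v K a) (schroedinger_op v)"
    by (rule A_op_commute[OF S(1) v(2)]) (use a_hol a0 rec stat in auto)
  moreover have "low_order_op S (2 * K) (\<lambda>f x. A_op v K a f x - (-1) ^ K * (deriv ^^ (2 * K + 1)) f x)"
    by (rule A_op_leading[OF S(1) v]) (use a_hol a_mero a0 in auto)
  ultimately show ?thesis
    by (rule commute_on_leading_imp_finite_gap_potential[OF v S])
qed

end

section \<open>The Treibich--Verdier potential\<close>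

text \<open>Replacing w by -w multiplies the Laurent coefficient of order i by (-1)^i, which keeps
  the coefficient at -2 and every vanishing condition. This reduces the poles at -\<delta>_k to
  those at \<delta>_k.\<close>

lemma trivial_monodromy_at_minus:
  assumes "\<And>x. v (- x) = v x" "trivial_monodromy_at v n p"
  shows "trivial_monodromy_at v n (- p)"
proof -
  obtain V where V: "(\<lambda>w. v (p + w)) has_laurent_expansion V" "V $$ (-2) = of_nat (n * (n + 1))"
    "\<And>i. i < -2 \<Longrightarrow> V $$ i = 0" "\<And>i. odd i \<Longrightarrow> i < 2 * int n \<Longrightarrow> V $$ i = 0"
    using assms(2) unfolding trivial_monodromy_at_def by blast
  have "(\<lambda>w::complex. (-1) * w) has_fps_expansion fps_const (-1) * fps_X"
    by (rule has_fps_expansion_cmult_left[OF has_fps_expansion_fps_X])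
  then have "((\<lambda>w. v (p + w)) \<circ> (\<lambda>w. (-1) * w)) has_laurent_expansion fls_compose_fps V (fps_const (-1) * fps_X)"
    by (intro has_laurent_expansion_compose[OF V(1)] has_laurent_expansion_fps) auto
  moreover have "(\<lambda>w. v (p + w)) \<circ> (\<lambda>w. (-1) * w) = (\<lambda>w. v (- p + w))"
    using assms(1) by (auto simp: fun_eq_iff) (metis minus_diff_eq uminus_add_conv_diff)
  ultimately have "(\<lambda>w. v (- p + w)) has_laurent_expansion fls_compose_fps V (fps_const (-1) * fps_X)"
    by simp
  then show ?thesis
    unfolding trivial_monodromy_at_def using V(2-4)
    by (intro exI[of _ "fls_compose_fps V (fps_const (-1) * fps_X)"]) (auto simp: fls_nth_fls_compose_fps_linear)
qed

locale treibich_verdier = lattice_basis +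
  fixes l :: "nat \<Rightarrow> nat" and M :: nat and \<delta> :: "nat \<Rightarrow> complex"
  assumes balance: "\<And>j. j \<in> {1..M} \<Longrightarrow>
           2 * (\<Sum>j'\<in>{1..M} - {j}. deriv \<wp> (\<delta> j - \<delta> j') + deriv \<wp> (\<delta> j + \<delta> j'))
           + (\<Sum>i=0..3. (of_nat (l i) + 1 / 2) ^ 2 * deriv \<wp> (\<delta> j + \<omega> i)) = 0"
    and not_half_period: "\<And>i j. i \<le> 3 \<Longrightarrow> j \<in> {1..M} \<Longrightarrow> \<delta> j - \<omega> i \<notin> \<Lambda>"
    and distinct: "\<And>j j'. 1 \<le> j \<Longrightarrow> j < j' \<Longrightarrow> j' \<le> M \<Longrightarrow> \<delta> j + \<delta> j' \<notin> \<Lambda> \<and> \<delta> j - \<delta> j' \<notin> \<Lambda>"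
begin

abbreviation v where "v \<equiv> potential \<omega>1 \<omega>3 l M \<delta>"
abbreviation S where "S \<equiv> regular_set \<omega>1 \<omega>3 M \<delta>"

lemma not_half_period': "i \<le> 3 \<Longrightarrow> j \<in> {1..M} \<Longrightarrow> \<delta> j + \<omega> i \<notin> \<Lambda>"
  using not_half_period[of i j] lattice_diff[of "\<delta> j + \<omega> i" "2 * \<omega> i"] double_half_period_in[of i]
  by (auto simp: algebra_simps)

text \<open>Otherwise \<delta>_j would be a half period modulo \<Lambda>. It keeps \<wp>(x +
  \<delta>_j) regular at \<delta>_j and makes the duplication formula applicable there.\<close>

lemma double_delta_notin: "j \<in> {1..M} \<Longrightarrow> 2 * \<delta> j \<notin> \<Lambda>"
  using not_half_period' by (metis double_in_lattice)

lemma distinct':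
  assumes "j \<in> {1..M}" "j' \<in> {1..M}" "j \<noteq> j'"
  shows "\<delta> j + \<delta> j' \<notin> \<Lambda>" "\<delta> j - \<delta> j' \<notin> \<Lambda>"
  using distinct[of j j'] distinct[of j' j] assms lattice_minus_iff[of "\<delta> j - \<delta> j'"]
  by (cases j j' rule: linorder_cases; auto simp: add.commute)+

lemma wp_shift_analytic: "c + z \<notin> \<Lambda> \<Longrightarrow> (\<lambda>w. \<wp> (w + c)) analytic_on {z}"
  by (intro analytic_on_shift wp_analytic)

lemma potential_eq:
  "v x = (\<Sum>i=0..3. of_nat (l i * (l i + 1)) * \<wp> (x + \<omega> i)) +
         2 * (\<Sum>k=1..M. \<wp> (x + - \<delta> k) + \<wp> (x + \<delta> k))"
  by (simp add: potential_def)

lemma potential_meromorphic: "v meromorphic_on UNIV"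
  unfolding potential_eq[abs_def] by (intro meromorphic_intros wp_shift_meromorphic)

lemma potential_analytic: "x \<in> S \<Longrightarrow> v analytic_on {x}"
  unfolding potential_eq[abs_def] regular_set_def
  by (intro analytic_intros wp_shift_analytic) (auto simp: add.commute)

lemma potential_holomorphic: "v holomorphic_on S"
  using potential_analytic analytic_imp_holomorphic analytic_on_analytic_at by blast

lemma potential_periodic: "p \<in> \<Lambda> \<Longrightarrow> v (x + p) = v x"
proof -
  assume p: "p \<in> \<Lambda>"
  have "\<wp> (x + p + c) = \<wp> (x + c)" for c
    using wp_periodic[OF p, of "x + c"] by (simp add: add_ac)
  then show ?thesis by (simp add: potential_eq del: add_uminus_conv_diff)
qed

lemma potential_minus: "v (- x) = v x"
proof -
  have 1: "\<wp> (- x + \<omega> i) = \<wp> (x + \<omega> i)" if "i \<in> {0..3}" for i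
    using wp_minus[of "x - \<omega> i"] wp_periodic[of "2 * \<omega> i" "x - \<omega> i"] double_half_period_in[of i] that
    by (simp add: algebra_simps)
  have "(\<Sum>i=0..3. of_nat (l i * (l i + 1)) * \<wp> (- x + \<omega> i)) = (\<Sum>i=0..3. of_nat (l i * (l i + 1)) * \<wp> (x + \<omega> i))"
    using 1 by (intro sum.cong) auto
  moreover have "\<wp> (- x + - \<delta> k) = \<wp> (x + \<delta> k)" "\<wp> (- x + \<delta> k) = \<wp> (x + - \<delta> k)" for k
    using wp_minus[of "x + \<delta> k"] wp_minus[of "x - \<delta> k"] by (simp_all add: algebra_simps)
  ultimately show ?thesis by (simp only: potential_eq) (simp add: add.commute)
qed

lemma eventually_regular: "eventually (\<lambda>y. y \<in> S) (at x)"
proof -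
  have ev: "eventually (\<lambda>y. y + c \<notin> \<Lambda>) (at x)" for c
  proof -
    have "eventually (\<lambda>y. y \<notin> \<Lambda>) (at (x + c))"
      using lattice_not_islimpt by (simp add: islimpt_iff_eventually)
    moreover have "filterlim (\<lambda>y. y + c) (at (x + c)) (at x)"
      by (intro filterlim_atI tendsto_intros) (auto simp: eventually_at_filter)
    ultimately show ?thesis using eventually_compose_filterlim by blast
  qed
  have "eventually (\<lambda>y. (\<forall>i\<in>{0..3}. y + \<omega> i \<notin> \<Lambda>) \<and> (\<forall>k\<in>{1..M}. y + \<delta> k \<notin> \<Lambda> \<and> y + - \<delta> k \<notin> \<Lambda>)) (at x)"
    by (intro eventually_conj eventually_ball_finite ballI ev) auto
  then show ?thesis
    by (rule eventually_mono) (auto simp: regular_set_def)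
qed

lemma open_regular: "open S"
proof -
  have "\<exists>T. open T \<and> x \<in> T \<and> T \<subseteq> S" if "x \<in> S" for x
    using eventually_regular[of x] that
    by (auto simp: eventually_at_filter eventually_nhds subset_iff)
  then show ?thesis by (subst open_subopen) auto
qed

text \<open>Since 2p is a period, evenness and periodicity make the potential even about p, so every
  odd coefficient of its regular part vanishes.\<close>

lemma trivial_monodromy_half_period:
  assumes "i0 \<le> 3" "p + \<omega> i0 \<in> \<Lambda>"
  shows "trivial_monodromy_at v (l i0) p"
proof -
  define r where "r = (\<lambda>w. of_nat (l i0 * (l i0 + 1)) * wp_reg w +
      (\<Sum>i\<in>{0..3} - {i0}. of_nat (l i * (l i + 1)) * \<wp> (w + (p + \<omega> i))) +
      2 * (\<Sum>k=1..M. \<wp> (w + (p - \<delta> k)) + \<wp> (w + (p + \<delta> k))))"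
  have "p + \<omega> i \<notin> \<Lambda>" if "i \<in> {0..3} - {i0}" for i
  proof
    assume "p + \<omega> i \<in> \<Lambda>"
    then have "(p + \<omega> i) - (p + \<omega> i0) \<in> \<Lambda>" using assms by blast
    then show False using half_period_diff_notin[of i i0] that assms by auto
  qed
  moreover have "p - \<delta> k \<notin> \<Lambda>" if "k \<in> {1..M}" for k
  proof
    assume "p - \<delta> k \<in> \<Lambda>"
    then have "(p + \<omega> i0) - (p - \<delta> k) \<in> \<Lambda>" using assms by blast
    then show False using not_half_period'[of i0 k] that assms by (auto simp: algebra_simps)
  qed
  moreover have "p + \<delta> k \<notin> \<Lambda>" if "k \<in> {1..M}" for k
  proof
    assume "p + \<delta> k \<in> \<Lambda>"
    then have "(p + \<delta> k) - (p + \<omega> i0) \<in> \<Lambda>" using assms by blast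
    then show False using not_half_period[of i0 k] that assms by (auto simp: algebra_simps)
  qed
  ultimately have r: "r analytic_on {0}"
    unfolding r_def by (intro analytic_intros wp_reg_analytic wp_shift_analytic) auto
  have eq: "v (p + w) = of_nat (l i0 * (l i0 + 1)) / w ^ 2 + r w" for w
  proof -
    have "(\<Sum>i=0..3. of_nat (l i * (l i + 1)) * \<wp> (p + w + \<omega> i)) =
       of_nat (l i0 * (l i0 + 1)) * \<wp> (p + w + \<omega> i0) + (\<Sum>i\<in>{0..3} - {i0}. of_nat (l i * (l i + 1)) * \<wp> (p + w + \<omega> i))"
      using assms by (intro sum.remove) auto
    moreover have "\<wp> (p + w + \<omega> i0) = 1 / w ^ 2 + wp_reg w"
      using wp_periodic[OF assms(2), of w] wp_eq_reg[of w] by (simp add: add_ac)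
    ultimately have "v (p + w) = of_nat (l i0 * (l i0 + 1)) * (1 / w ^ 2 + wp_reg w) +
        (\<Sum>i\<in>{0..3} - {i0}. of_nat (l i * (l i + 1)) * \<wp> (p + w + \<omega> i)) +
        2 * (\<Sum>k=1..M. \<wp> (p + w + - \<delta> k) + \<wp> (p + w + \<delta> k))"
      by (simp only: potential_eq)
    also have "\<dots> = of_nat (l i0 * (l i0 + 1)) / w ^ 2 + r w"
      by (simp add: r_def distrib_left add_ac diff_conv_add_uminus del: add_uminus_conv_diff)
    finally show ?thesis .
  qed
  have "2 * p \<in> \<Lambda>"
    using lattice_diff[OF lattice_add[OF assms(2,2)] double_half_period_in[OF assms(1)]] by (simp add: algebra_simps)
  then have "v (p + - w) = v (p + w)" for w
    using potential_minus[of "p - w"] potential_periodic[of "2 * p" "w - p"] by (simp add: algebra_simps)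
  then have "r (- w) = r w" for w
    using eq[of w] eq[of "- w"] by simp
  then show ?thesis
    by (intro trivial_monodromy_atI[OF r] always_eventually allI eq higher_deriv_even_eq_0[OF r]) auto
qed

text \<open>The double pole has coefficient 2 = 1 (1 + 1), so l = 1 and the only condition is that
  r' vanishes at 0. The duplication formula turns 2 \<wp>'(2 \<delta>) into a quarter of \<Sum>
  \<wp>'(\<delta> + \<omega>_i); as l_i (l_i + 1) + 1/4 = (l_i + 1/2)^2, the condition becomes
  \<open>balance\<close>.\<close>

lemma trivial_monodromy_delta:
  assumes k0: "k0 \<in> {1..M}"
  shows "trivial_monodromy_at v 1 (\<delta> k0)"
proof -
  define r where "r = (\<lambda>w. (\<Sum>i=0..3. of_nat (l i * (l i + 1)) * \<wp> (w + (\<delta> k0 + \<omega> i))) +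
      2 * (wp_reg w + \<wp> (w + 2 * \<delta> k0) + (\<Sum>k\<in>{1..M} - {k0}. \<wp> (w + (\<delta> k0 - \<delta> k)) + \<wp> (w + (\<delta> k0 + \<delta> k)))))"
  note notin = not_half_period'[OF _ k0] double_delta_notin[OF k0] distinct'[OF k0]
  have r: "r analytic_on {0}"
    unfolding r_def using notin
    by (intro analytic_intros wp_reg_analytic wp_shift_analytic) auto
  have eq: "v (\<delta> k0 + w) = of_nat (1 * (1 + 1)) / w ^ 2 + r w" for w
  proof -
    have "(\<Sum>k=1..M. \<wp> (\<delta> k0 + w + - \<delta> k) + \<wp> (\<delta> k0 + w + \<delta> k)) =
       (\<wp> (\<delta> k0 + w + - \<delta> k0) + \<wp> (\<delta> k0 + w + \<delta> k0)) + (\<Sum>k\<in>{1..M} - {k0}. \<wp> (\<delta> k0 + w + - \<delta> k) + \<wp> (\<delta> k0 + w + \<delta> k))"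
      using k0 by (intro sum.remove) auto
    moreover have "\<wp> (\<delta> k0 + w + - \<delta> k0) = 1 / w ^ 2 + wp_reg w"
      using wp_eq_reg[of w] by simp
    moreover have "\<delta> k0 + w + \<delta> k0 = w + 2 * \<delta> k0" by simp
    ultimately have "v (\<delta> k0 + w) = (\<Sum>i=0..3. of_nat (l i * (l i + 1)) * \<wp> (\<delta> k0 + w + \<omega> i)) +
       2 * ((1 / w ^ 2 + wp_reg w + \<wp> (w + 2 * \<delta> k0)) + (\<Sum>k\<in>{1..M} - {k0}. \<wp> (\<delta> k0 + w + - \<delta> k) + \<wp> (\<delta> k0 + w + \<delta> k)))"
      by (simp only: potential_eq)
    also have "\<dots> = of_nat (1 * (1 + 1)) / w ^ 2 + r w"
      by (simp add: r_def distrib_left add_ac diff_conv_add_uminus del: add_uminus_conv_diff)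
    finally show ?thesis .
  qed
  have D: "((\<lambda>w. \<wp> (w + c)) has_field_derivative deriv \<wp> c) (at 0)" if "c \<notin> \<Lambda>" for c
    using wp_deriv[OF that] DERIV_shift[of "\<wp>" "deriv \<wp> c" 0 c] by simp
  have "(wp_reg has_field_derivative deriv wp_reg 0) (at 0)"
    by (intro analytic_derivI wp_reg_analytic)
  moreover have "deriv wp_reg 0 = 0"
    using higher_deriv_even_eq_0[OF wp_reg_analytic, of 1] wp_reg_minus by simp
  ultimately have D_reg: "(wp_reg has_field_derivative 0) (at 0)" by simp
  have "(r has_field_derivative (\<Sum>i=0..3. of_nat (l i * (l i + 1)) * deriv \<wp> (\<delta> k0 + \<omega> i)) +
      2 * (0 + deriv \<wp> (2 * \<delta> k0) + (\<Sum>k\<in>{1..M} - {k0}. deriv \<wp> (\<delta> k0 - \<delta> k) + deriv \<wp> (\<delta> k0 + \<delta> k)))) (at 0)"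
    unfolding r_def using notin
    by (intro DERIV_add DERIV_sum DERIV_cmult D D_reg) auto
  then have "deriv r 0 = (\<Sum>i=0..3. of_nat (l i * (l i + 1)) * deriv \<wp> (\<delta> k0 + \<omega> i)) +
      2 * deriv \<wp> (2 * \<delta> k0) + 2 * (\<Sum>k\<in>{1..M} - {k0}. deriv \<wp> (\<delta> k0 - \<delta> k) + deriv \<wp> (\<delta> k0 + \<delta> k))"
    using DERIV_imp_deriv by (force simp: algebra_simps)
  also have "2 * deriv \<wp> (2 * \<delta> k0) = 1 / 4 * (\<Sum>i=0..3. deriv \<wp> (\<delta> k0 + \<omega> i))"
    using wp_duplication_deriv[OF notin(2)] by simp
  also have "(\<Sum>i=0..3. of_nat (l i * (l i + 1)) * deriv \<wp> (\<delta> k0 + \<omega> i)) + 1 / 4 * (\<Sum>i=0..3. deriv \<wp> (\<delta> k0 + \<omega> i)) =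
      (\<Sum>i=0..3. (of_nat (l i) + 1 / 2) ^ 2 * deriv \<wp> (\<delta> k0 + \<omega> i))"
    unfolding sum_distrib_left sum.distrib[symmetric]
    by (intro sum.cong) (auto simp: power2_eq_square algebra_simps)
  finally have "deriv r 0 = 0"
    using balance[OF k0] by (simp add: algebra_simps)
  then have "(deriv ^^ n) r 0 = 0" if "odd n" "n < 2 * 1" for n
    using that by (cases n) auto
  then show ?thesis
    by (intro trivial_monodromy_atI[OF r] always_eventually allI eq)
qed

lemma potential_finite_gap: "finite_gap_potential v"
proof (rule trivial_monodromy_imp_finite_gap_potential)
  let ?P = "(\<lambda>i. - \<omega> i) ` {0..3} \<union> \<delta> ` {1..M} \<union> (\<lambda>k. - \<delta> k) ` {1..M}"
  show "finite ?P" by auto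
  show "\<exists>p\<in>?P. x - p \<in> \<Lambda>" if "x \<notin> S" for x
    using that unfolding regular_set_def by (auto simp: bex_Un)
  show "\<exists>n. trivial_monodromy_at v n p" if p: "p \<in> ?P" for p
  proof -
    consider i where "i \<le> 3" "p = - \<omega> i" | k where "k \<in> {1..M}" "p = \<delta> k" | k where "k \<in> {1..M}" "p = - \<delta> k"
      using p by auto
    then show ?thesis
    proof cases
      case 1
      then show ?thesis using trivial_monodromy_half_period[of i p] by auto
    next
      case 2
      then show ?thesis using trivial_monodromy_delta by blast
    next
      case 3
      then show ?thesis using trivial_monodromy_at_minus[OF potential_minus trivial_monodromy_delta] by blast
    qed
  qed
qed (use potential_meromorphic potential_holomorphic open_regular eventually_regular potential_periodic in auto)

end

section \<open>From the third-order equation for \<Xi> to the commuting operator\<close>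

lemma kdv_op_cong:
  assumes "open U" "x \<in> U" "\<And>y. y \<in> U \<Longrightarrow> f y = g y"
  shows "kdv_op v f x = kdv_op v g x"
proof -
  have 1: "deriv f y = deriv g y" if "y \<in> U" for y
    using assms that by (intro deriv_cong_ev) (auto simp: eventually_nhds)
  have 2: "deriv (deriv f) y = deriv (deriv g) y" if "y \<in> U" for y
    using assms 1 that by (intro deriv_cong_ev) (auto simp: eventually_nhds)
  have "deriv (deriv (deriv f)) x = deriv (deriv (deriv g)) x"
    using assms 2 by (intro deriv_cong_ev) (auto simp: eventually_nhds)
  then show ?thesis using 1 assms by (simp add: kdv_op_def)
qed

text \<open>At fixed x both sides of the equation are polynomials in E, the right one shifted by one
  degree. Order g + 1 gives the constancy of a_0, order 0 the stationarity, and order g - j the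
  recursion from a_j to a_(j+1).\<close>

lemma kdv_generating_polynomial_recursion:
  assumes S: "open S" "x \<in> S" and a: "\<And>j. j \<le> g \<Longrightarrow> a j holomorphic_on S"
    and \<Xi>: "\<And>y E. y \<in> S \<Longrightarrow> \<Xi> y E = (\<Sum>i=0..g. a (g - i) y * E ^ i)"
    and eq: "\<And>E. kdv_op v (\<lambda>y. \<Xi> y E) x = 4 * E * deriv (\<lambda>y. \<Xi> y E) x"
  shows "deriv (a 0) x = 0" "\<And>j. j < g \<Longrightarrow> 4 * deriv (a (Suc j)) x = kdv_op v (a j) x"
    "kdv_op v (a g) x = 0"
proof -
  define p where "p = (\<Sum>i=0..g. monom (kdv_op v (a (g - i)) x) i)"
  define q where "q = (\<Sum>i=0..g. monom (4 * deriv (a (g - i)) x) (Suc i))"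
  have "poly p E = poly q E" for E
  proof -
    have \<Xi>': "\<Xi> y E = (\<Sum>i=0..g. E ^ i * a (g - i) y)" if "y \<in> S" for y
      unfolding \<Xi>[OF that] by (simp add: mult.commute)
    have "kdv_op v (\<lambda>y. \<Xi> y E) x = kdv_op v (\<lambda>y. \<Sum>i=0..g. E ^ i * a (g - i) y) x"
      using S \<Xi>' by (intro kdv_op_cong)
    also have "\<dots> = (\<Sum>i=0..g. E ^ i * kdv_op v (a (g - i)) x)"
      using S a by (intro kdv_op_sum) auto
    finally have 1: "kdv_op v (\<lambda>y. \<Xi> y E) x = poly p E"
      by (simp add: p_def poly_sum poly_monom mult.commute)
    have "deriv (\<lambda>y. \<Xi> y E) x = deriv (\<lambda>y. \<Sum>i=0..g. E ^ i * a (g - i) y) x"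
      using S \<Xi>' by (intro deriv_cong_ev) (auto simp: eventually_nhds)
    also have "\<dots> = (\<Sum>i=0..g. E ^ i * deriv (a (g - i)) x)"
      using S a by (intro DERIV_imp_deriv DERIV_sum DERIV_cmult holomorphic_derivI[of _ S]) auto
    finally have "4 * E * deriv (\<lambda>y. \<Xi> y E) x = poly q E"
      by (simp add: q_def poly_sum poly_monom sum_distrib_left algebra_simps)
    then show ?thesis using eq 1 by simp
  qed
  then have "p = q" by (intro poly_ext)
  have p: "coeff p n = (if n \<le> g then kdv_op v (a (g - n)) x else 0)" for n
    by (simp add: p_def coeff_sum if_distrib sum.delta cong: if_cong)
  have q: "coeff q n = (if 1 \<le> n \<and> n \<le> Suc g then 4 * deriv (a (Suc g - n)) x else 0)" for n
    by (cases n) (simp_all add: q_def coeff_sum if_distrib sum.delta cong: if_cong)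
  show "deriv (a 0) x = 0"
    using p[of "Suc g"] q[of "Suc g"] \<open>p = q\<close> by simp
  show "kdv_op v (a g) x = 0"
    using p[of 0] q[of 0] \<open>p = q\<close> by simp
  show "4 * deriv (a (Suc j)) x = kdv_op v (a j) x" if "j < g" for j
  proof -
    define n where "n = g - j"
    have n: "j = g - n" "1 \<le> n" "n \<le> g" using that by (auto simp: n_def)
    then show ?thesis using p[of n] q[of n] \<open>p = q\<close> by (simp add: Suc_diff_le)
  qed
qed

context treibich_verdier
begin

text \<open>The functions \<open>a j\<close> are known only through the expansion in E. Comparing
  coefficients at each x exhibits them on \<open>S\<close> as explicit combinations of powers of
  shifted \<wp>.\<close>

lemma Xi_coefficients_holomorphic:
  assumes \<Xi>: "\<And>x E. x \<in> S \<Longrightarrow> Xi \<omega>1 \<omega>3 l M \<delta> c0 b d x E = (\<Sum>i=0..g. a (g - i) x * E ^ i)"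
    and j: "j \<le> g"
  shows "a j holomorphic_on S"
proof -
  define h where "h x = coeff c0 (g - j) +
     (\<Sum>i=0..3. \<Sum>k<l i. coeff (b i k) (g - j) * \<wp> (x + \<omega> i) ^ (l i - k)) +
     (\<Sum>k=1..M. coeff (d k) (g - j) * (\<wp> (x + \<delta> k) + \<wp> (x + - \<delta> k)))" for x
  have "a j x = h x" if x: "x \<in> S" for x
  proof -
    define p where "p = c0 + (\<Sum>i=0..3. \<Sum>k<l i. smult (\<wp> (x + \<omega> i) ^ (l i - k)) (b i k)) +
      (\<Sum>k=1..M. smult (\<wp> (x + \<delta> k) + \<wp> (x - \<delta> k)) (d k))"
    define q where "q = (\<Sum>i=0..g. monom (a (g - i) x) i)"
    have "poly p E = poly q E" for E
      using \<Xi>[OF x, of E] by (simp add: p_def q_def Xi_def poly_sum poly_monom mult.commute)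
    then have "p = q" by (intro poly_ext)
    then have "coeff p (g - j) = coeff q (g - j)" by simp
    moreover have "coeff q (g - j) = a j x"
      using j by (simp add: q_def coeff_sum if_distrib sum.delta cong: if_cong)
    moreover have "coeff p (g - j) = h x"
      by (simp add: p_def h_def coeff_sum mult.commute)
    ultimately show ?thesis by simp
  qed
  moreover have "h holomorphic_on S"
  proof -
    have "h analytic_on {x}" if "x \<in> S" for x
      using that unfolding h_def[abs_def] regular_set_def
      by (intro analytic_intros wp_shift_analytic) (auto simp: add.commute)
    then show ?thesis using analytic_imp_holomorphic analytic_on_analytic_at by blast
  qed
  ultimately show ?thesis using holomorphic_cong by metis
qed

lemma A_op_commute_potential:
  assumes coeffs: "is_Xi_coeffs \<omega>1 \<omega>3 l M \<delta> c0 b d"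
    and \<Xi>: "\<And>x E. x \<in> S \<Longrightarrow> Xi \<omega>1 \<omega>3 l M \<delta> c0 b d x E = (\<Sum>i=0..degree c0. a (degree c0 - i) x * E ^ i)"
  shows "commute_on S (A_op v (degree c0) a) (schroedinger_op v)"
proof -
  note hol = Xi_coefficients_holomorphic[OF \<Xi>]
  have ode: "kdv_op v (\<lambda>y. Xi \<omega>1 \<omega>3 l M \<delta> c0 b d y E) x = 4 * E * deriv (\<lambda>y. Xi \<omega>1 \<omega>3 l M \<delta> c0 b d y E) x"
    if "x \<in> S" for x E
    using coeffs that unfolding is_Xi_coeffs_def Let_def kdv_op_def
    by (auto simp: numeral_3_eq_3 algebra_simps)
  note rec = kdv_generating_polynomial_recursion[OF open_regular _ hol \<Xi> ode]
  show ?thesis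
    by (rule A_op_commute[OF open_regular potential_holomorphic]) (use hol rec in auto)
qed

end

text \<open>If the imaginary part vanished, \<omega>1 would be a real multiple of \<omega>3.
  Distinctness matters because for equal periods the set collapses to a singleton, which can be
  independent.\<close>

lemma lattice_basisI:
  assumes "\<omega>1 \<noteq> \<omega>3" "independent {\<omega>1, \<omega>3}"
  shows "lattice_basis \<omega>1 \<omega>3"
proof
  show "Im (\<omega>1 * cnj \<omega>3) \<noteq> 0"
  proof
    assume "Im (\<omega>1 * cnj \<omega>3) = 0"
    then have r: "\<omega>1 * cnj \<omega>3 = of_real (Re (\<omega>1 * cnj \<omega>3))" by (simp add: complex_eq_iff)
    have ne: "\<omega>3 \<noteq> 0" using assms(2) dependent_zero by blast
    have "\<omega>1 * of_real (norm \<omega>3 ^ 2) = of_real (Re (\<omega>1 * cnj \<omega>3)) * \<omega>3"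
      unfolding complex_norm_square by (subst r[symmetric]) (simp add: mult_ac)
    then have "\<omega>1 = (Re (\<omega>1 * cnj \<omega>3) / norm \<omega>3 ^ 2) *\<^sub>R \<omega>3"
      using ne by (simp add: scaleR_conv_of_real field_simps)
    then have "\<omega>1 \<in> span {\<omega>3}" by (metis span_base span_scale insertI1)
    then show False
      using assms by (simp add: independent_insert)
  qed
qed

theorem theorem4p5:
  fixes \<omega>1 \<omega>3 :: complex and l :: "nat \<Rightarrow> nat" and M :: nat and \<delta> :: "nat \<Rightarrow> complex"
  assumes "\<omega>1 \<noteq> \<omega>3" and "independent {\<omega>1, \<omega>3}"
    and "\<And>j. j \<in> {1..M} \<Longrightarrow>
           2 * (\<Sum>j'\<in>{1..M} - {j}. deriv (wp \<omega>1 \<omega>3) (\<delta> j - \<delta> j') + deriv (wp \<omega>1 \<omega>3) (\<delta> j + \<delta> j'))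
           + (\<Sum>i=0..3. (of_nat (l i) + 1 / 2) ^ 2 *
                deriv (wp \<omega>1 \<omega>3) (\<delta> j + half_period \<omega>1 \<omega>3 i)) = 0"
    and "\<And>i j. i \<le> 3 \<Longrightarrow> j \<in> {1..M} \<Longrightarrow>
           \<delta> j - half_period \<omega>1 \<omega>3 i \<notin> period_lattice \<omega>1 \<omega>3"
    and "\<And>j j'. 1 \<le> j \<Longrightarrow> j < j' \<Longrightarrow> j' \<le> M \<Longrightarrow>
           \<delta> j + \<delta> j' \<notin> period_lattice \<omega>1 \<omega>3 \<and> \<delta> j - \<delta> j' \<notin> period_lattice \<omega>1 \<omega>3"
  shows "(\<forall>c0 b d a.
            is_Xi_coeffs \<omega>1 \<omega>3 l M \<delta> c0 b d \<and>
            (\<forall>x \<in> regular_set \<omega>1 \<omega>3 M \<delta>. \<forall>E.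
               Xi \<omega>1 \<omega>3 l M \<delta> c0 b d x E = (\<Sum>i=0..degree c0. a (degree c0 - i) x * E ^ i))
            \<longrightarrow> commute_on (regular_set \<omega>1 \<omega>3 M \<delta>)
                  (A_op (potential \<omega>1 \<omega>3 l M \<delta>) (degree c0) a)
                  (schroedinger_op (potential \<omega>1 \<omega>3 l M \<delta>)))
         \<and> finite_gap_potential (potential \<omega>1 \<omega>3 l M \<delta>)"
proof -
  interpret lattice_basis \<omega>1 \<omega>3
    by (rule lattice_basisI) fact+
  interpret treibich_verdier \<omega>1 \<omega>3 l M \<delta>
    by unfold_locales fact+
  show ?thesis
    using A_op_commute_potential potential_finite_gap by blast
qed

end
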